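(* Let $\phi:\mathbb{Z}^d\rightarrow\mathbb{C}$ be finitely supported and such that $\sup_{\xi\in\mathbb{T}^d}|\hat\phi(\xi)|=1$. Suppose that every point $\xi\in\Omega(\phi)$ is of positive homogeneous type for $\hat\phi$ and that every $\xi\in\Omega(\phi)$ has the same drift $\alpha=\alpha_{\xi}\in\mathbb{R}^d$ and the same positive homogeneous polynomial $P=P_{\xi}$. Let $\mu_\phi=\mu_P$ and let $R^{\#}$ be the Legendre-Fenchel transform of $R=\operatorname{Re} P$. Then there exist $C,M>0$ for which $$|\phi^{(n)}(x)|\leq\frac{C}{n^{\mu_\phi}}\exp\left(-nMR^{\#}\left(\frac{x-n\alpha }{n}\right)\right)$$ for all $n\in\mathbb{N}_+=\{1,2,\dots\}$ and $x\in\mathbb{Z}^d$.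
   Context: Let $d\ge 1$. For finitely supported $\phi:\mathbb{Z}^d\to\mathbb{C}$, set $\phi^{(1)}=\phi$ and $\phi^{(n)}=\phi^{(n-1)}*\phi$, where $(\psi*\phi)(x)=\sum_{y\in\mathbb{Z}^d}\psi(x-y)\phi(y)$. The Fourier transform is $\hat\phi(\xi)=\sum_{x\in\mathbb{Z}^d}\phi(x)e^{ix\cdot\xi}$, $\xi\in\mathbb{R}^d$. Let $\mathbb{T}^d=(-\pi,\pi]^d$. For $E\in M_d(\mathbb{R})$ and $t>0$, $t^E=\exp((\log t)E)$. For a continuous $P:\mathbb{R}^d\to\mathbb{C}$, $\mathrm{Exp}(P)$ is the set of $E\in M_d(\mathbb{R})$ with $tP(\xi)=P(t^E\xi)$ for all $t>0$, $\xi\in\mathbb{R}^d$. $P$ is positive homogeneous if $R=\operatorname{Re}P$ is positive definite ($R(\xi)\ge 0$, with $R(\xi)=0$ only when $\xi=0$) and $\mathrm{Exp}(P)$ contains a matrix with real spectrum. For a positive homogeneous polynomial $P$ (complex coefficients, $d$ real variables), $\mu_P:=\operatorname{tr}E$ for any $E\in\mathrm{Exp}(P)$ (this is independent of the choice of $E$). The Legendre-Fenchel transform of $R:\mathbb{R}^d\to\mathbb{R}$ is $R^{\#}(x)=\sup_{\xi\in\mathbb{R}^d}\{x\cdot\xi-R(\xi)\}$. When $\sup|\hat\phi|=1$, $\Omega(\phi)=\{\xi\in\mathbb{T}^d:|\hat\phi(\xi)|=1\}$. For $\xi_0\in\Omega(\phi)$ put $\Gamma_{\xi_0}(\xi)=\log\big(\hat\phi(\xi+\xi_0)/\hat\phi(\xi_0)\big)$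 (principal branch) on a sufficiently small convex open neighborhood $\mathcal{U}$ of $0$. The point $\xi_0$ is of positive homogeneous type for $\hat\phi$ if the Taylor expansion of $\Gamma_{\xi_0}$ about $0$ is of the form $\Gamma_{\xi_0}(\xi)=i\alpha_{\xi_0}\cdot\xi-P_{\xi_0}(\xi)+\Upsilon_{\xi_0}(\xi)$, where $\alpha_{\xi_0}\in\mathbb{R}^d$ (the drift), $P_{\xi_0}$ is a positive homogeneous polynomial, and $\Upsilon_{\xi_0}(\xi)=o(\operatorname{Re}P_{\xi_0}(\xi))$ as $\xi\to 0$; then $\alpha_{\xi_0}$ and $P_{\xi_0}$ are unique. *)

theory Defs
  imports "HOL-Analysis.Analysis" "HOL-Library.Landau_Symbols"
begin

definition real_vec :: "int ^ 'd \<Rightarrow> real ^ 'd::finite" where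
  "real_vec x = (\<chi> i. real_of_int (x $ i))"

definition conv :: "(int ^ 'd \<Rightarrow> complex) \<Rightarrow> (int ^ 'd \<Rightarrow> complex) \<Rightarrow> int ^ 'd::finite \<Rightarrow> complex" where
  "conv \<psi> \<phi> x = (\<Sum>\<^sub>\<infinity>y. \<psi> (x - y) * \<phi> y)"

(* The value at 0, the unit for convolution, is only there to make the function total. *)
fun conv_power :: "(int ^ 'd \<Rightarrow> complex) \<Rightarrow> nat \<Rightarrow> int ^ 'd::finite \<Rightarrow> complex" where
  "conv_power \<phi> 0 = (\<lambda>x. if x = 0 then 1 else 0)"
| "conv_power \<phi> (Suc 0) = \<phi>"
| "conv_power \<phi> (Suc (Suc n)) = conv (conv_power \<phi> (Suc n)) \<phi>"

definition fourier :: "(int ^ 'd \<Rightarrow> complex) \<Rightarrow> real ^ 'd::finite \<Rightarrow> complex" where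
  "fourier \<phi> \<xi> = (\<Sum>\<^sub>\<infinity>x. \<phi> x * exp (\<i> * complex_of_real (real_vec x \<bullet> \<xi>)))"

definition torus :: "(real ^ 'd::finite) set" where
  "torus = {\<xi>. \<forall>i. - pi < \<xi> $ i \<and> \<xi> $ i \<le> pi}"

(* The library's power and product on the type real ^ 'd ^ 'd are componentwise,
   hence the separate power and exponential for the matrix product. *)
primrec matrix_power :: "real ^ 'd ^ 'd \<Rightarrow> nat \<Rightarrow> real ^ 'd ^ 'd::finite" where
  "matrix_power A 0 = mat 1"
| "matrix_power A (Suc k) = A ** matrix_power A k"

definition matrix_exp :: "real ^ 'd ^ 'd \<Rightarrow> real ^ 'd ^ 'd::finite" where
  "matrix_exp A = (\<Sum>k. (1 / fact k) *\<^sub>R matrix_power A k)"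

(* t^E, meant for t > 0 *)
definition powr_matrix :: "real \<Rightarrow> real ^ 'd ^ 'd \<Rightarrow> real ^ 'd ^ 'd::finite" where
  "powr_matrix t E = matrix_exp (ln t *\<^sub>R E)"

definition complex_spectrum :: "real ^ 'd ^ 'd::finite \<Rightarrow> complex set" where
  "complex_spectrum E = {z. \<exists>v. v \<noteq> 0 \<and> map_matrix complex_of_real E *v v = z *s v}"

definition Exp_set :: "(real ^ 'd \<Rightarrow> complex) \<Rightarrow> (real ^ 'd ^ 'd::finite) set" where
  "Exp_set P = {E. \<forall>t>0. \<forall>\<xi>. complex_of_real t * P \<xi> = P (powr_matrix t E *v \<xi>)}"

definition positive_definite_fun :: "(real ^ 'd::finite \<Rightarrow> real) \<Rightarrow> bool" where
  "positive_definite_fun R \<longleftrightarrow> (\<forall>\<xi>. R \<xi> \<ge> 0 \<and> (R \<xi> = 0 \<longrightarrow> \<xi> = 0))"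

definition positive_homogeneous :: "(real ^ 'd::finite \<Rightarrow> complex) \<Rightarrow> bool" where
  "positive_homogeneous P \<longleftrightarrow>
     continuous_on UNIV P \<and> positive_definite_fun (\<lambda>\<xi>. Re (P \<xi>)) \<and>
     (\<exists>E \<in> Exp_set P. complex_spectrum E \<subseteq> \<real>)"

(* For maps into the real vector space complex, polynomial_function says that the real and
   imaginary parts are real polynomials in the d coordinates, that is, complex coefficients. *)
definition positive_homogeneous_polynomial :: "(real ^ 'd::finite \<Rightarrow> complex) \<Rightarrow> bool" where
  "positive_homogeneous_polynomial P \<longleftrightarrow> polynomial_function P \<and> positive_homogeneous P"

(* For a positive homogeneous polynomial the trace does not depend on the chosen exponent. *)
definition homogeneous_order :: "(real ^ 'd::finite \<Rightarrow> complex) \<Rightarrow> real" where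
  "homogeneous_order P = trace (SOME E. E \<in> Exp_set P)"

(* Real-valued: the supremum is finite when R is the real part of a positive homogeneous
   polynomial; for R whose supremum is infinite the value is unspecified. *)
definition legendre_fenchel :: "(real ^ 'd \<Rightarrow> real) \<Rightarrow> real ^ 'd::finite \<Rightarrow> real" where
  "legendre_fenchel R x = (SUP \<xi>. x \<bullet> \<xi> - R \<xi>)"

definition Omega :: "(int ^ 'd \<Rightarrow> complex) \<Rightarrow> (real ^ 'd::finite) set" where
  "Omega \<phi> = {\<xi> \<in> torus. cmod (fourier \<phi> \<xi>) = 1}"

definition Gamma_log :: "(int ^ 'd \<Rightarrow> complex) \<Rightarrow> real ^ 'd \<Rightarrow> real ^ 'd::finite \<Rightarrow> complex" where
  "Gamma_log \<phi> \<xi>\<^sub>0 \<xi> = Ln (fourier \<phi> (\<xi> + \<xi>\<^sub>0) / fourier \<phi> \<xi>\<^sub>0)"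

(* xi0 is of positive homogeneous type with drift alpha and polynomial P; alpha and P are
   determined by phi and xi0.  Neighborhoods U on which Ln meets its branch cut do no harm,
   as U may always be shrunk. *)
definition positive_homogeneous_type ::
  "(int ^ 'd \<Rightarrow> complex) \<Rightarrow> real ^ 'd::finite \<Rightarrow> real ^ 'd \<Rightarrow> (real ^ 'd \<Rightarrow> complex) \<Rightarrow> bool" where
  "positive_homogeneous_type \<phi> \<xi>\<^sub>0 \<alpha> P \<longleftrightarrow>
     positive_homogeneous_polynomial P \<and>
     (\<exists>U \<Upsilon>. open U \<and> convex U \<and> 0 \<in> U \<and>
        (\<forall>\<xi>\<in>U. Gamma_log \<phi> \<xi>\<^sub>0 \<xi> = \<i> * complex_of_real (\<alpha> \<bullet> \<xi>) - P \<xi> + \<Upsilon> \<xi>) \<and>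
        \<Upsilon> \<in> o[at 0](\<lambda>\<xi>. complex_of_real (Re (P \<xi>))))"

end

theory Submission
  imports Defs "HOL-Complex_Analysis.Cauchy_Integral_Formula"
begin

text \<open>
The convolution power \<open>\<phi>\<^sup>(\<^sup>n\<^sup>)\<close> has Fourier transform \<open>f ^ n\<close>, where \<open>f\<close> is the transform of \<open>\<phi>\<close>. Multiplying \<open>\<phi>\<close> by
\<open>exp (x \<bullet> \<nu>)\<close> replaces \<open>f(\<xi>)\<close> by \<open>f(\<xi> - \<i> \<nu>)\<close> and multiplies the convolution power at \<open>x\<close> by \<open>exp (x \<bullet> \<nu>)\<close>. Fourier
inversion then gives, for every real \<open>\<nu>\<close>,
\<open>\<bar>\<phi>\<^sup>(\<^sup>n\<^sup>)(x)\<bar> exp (x \<bullet> \<nu>) \<le> \<integral> \<bar>f(\<xi> - \<i> \<nu>)\<bar>\<^sup>n d\<xi>\<close> over a period box, up to normalisation. The theorem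
follows by bounding the integrand and then choosing \<open>\<nu>\<close>.

The integrand. Let \<open>R\<close> be the real part of \<open>P\<close>. Near a maximum \<open>\<xi>0\<close> of the modulus of \<open>f\<close> one wants
\<open>\<bar>f(\<xi>0 + \<xi> - \<i> \<nu>)\<bar> \<le> exp (\<alpha> \<bullet> \<nu> - R(\<xi>) / 4 + M R(\<nu>))\<close> (lemma \<open>local_estimate\<close>). The hypothesis describes
\<open>log f\<close> at real frequencies only, with a remainder \<open>o(R)\<close>. Since \<open>log f\<close> is analytic on complex lines,
its value at \<open>\<xi> - \<i> \<nu>\<close> can be interpolated from the real points \<open>\<xi> + k \<nu>\<close> with \<open>0 \<le> k \<le> N\<close>, with an error of order
\<open>\<bar>\<nu>\<bar>\<^sup>N\<^sup>+\<^sup>1\<close> (lemma \<open>interpolation_error_bounded_holomorphic\<close>). For large \<open>N\<close> this is negligible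
against \<open>R(\<nu>)\<close>, because \<open>R\<close> vanishes to finite order only. The remaining comparisons are between functions that are
homogeneous under the maps \<open>t\<^sup>E\<close>, and they follow from compactness of the level set
\<open>R(\<xi>) + R(\<nu>) = 1\<close> (locale \<open>homogeneous_flow\<close>); the key is that a positive definite homogeneous \<open>R\<close> is
bounded away from 0 outside every ball. Away from the maxima there is a gap below 1, and for large \<open>\<nu>\<close> the term \<open>M R(\<nu>)\<close>
dominates the exponential growth of \<open>f\<close> (lemma \<open>global_estimate\<close>).

The integral. The substitution \<open>\<xi> \<mapsto> n\<^sup>E \<xi>\<close> turns \<open>exp (- n R)\<close> into \<open>exp (- R)\<close> and has determinant
\<open>n\<^sup>t\<^sup>r \<^sup>E\<close>, which yields the factor \<open>n\<^sup>-\<^sup>\<mu>\<close>; here \<open>E\<close> is the exponent selected in the definition of \<open>\<mu>\<close>.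

The choice of \<open>\<nu>\<close>. With \<open>y = (x - n \<alpha>) / n\<close> the bound reads, up to the factor \<open>C n\<^sup>-\<^sup>\<mu>\<close>,
\<open>exp (- n (y \<bullet> \<nu> - M R(\<nu>)))\<close>, for all \<open>\<nu>\<close>. Because \<open>R\<close> is flat at 0 and homogeneous, there is a scalar \<open>s > 0\<close> with
\<open>M R(s \<nu>) \<le> s R(\<nu>)\<close> for all \<open>\<nu>\<close>, so replacing \<open>\<nu>\<close> by \<open>s \<nu>\<close> gives
\<open>exp (- n s (y \<bullet> \<nu> - R(\<nu>)))\<close>, and the supremum over \<open>\<nu>\<close> produces the Legendre-Fenchel transform.
\<close>

section \<open>Interpolation of holomorphic functions at integer nodes\<close>

text \<open>Lagrange interpolation at the nodes \<open>0, \<dots>, N\<close>: the value of a polynomial at a complex point is a fixed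
linear combination of its values at real points. With \<open>w = - \<i>\<close> this is the device that
transports information about a Taylor expansion from real to complex frequencies, one line at a time.\<close>

lemma interpolation_weights_exist:
  fixes w :: complex
  obtains c :: "nat \<Rightarrow> complex"
  where "\<And>p. degree p \<le> N \<Longrightarrow> (\<Sum>k\<le>N. c k * poly p (of_nat k)) = poly p w"
proof -
  define L :: "nat \<Rightarrow> complex poly" where "L k = (\<Prod>j\<in>{..N} - {k}. [:- of_nat j, 1:])" for k
  have polyL: "poly (L k) z = (\<Prod>j\<in>{..N} - {k}. z - of_nat j)" for k z
    by (simp add: L_def poly_prod)
  have degL: "degree (L k) \<le> N" if "k \<le> N" for k
  proof -
    have "degree (L k) \<le> (\<Sum>j\<in>{..N} - {k}. degree [:- of_nat j, 1 :: complex:])"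
      unfolding L_def using degree_prod_sum_le[of "{..N} - {k}" "\<lambda>j. [:- of_nat j, 1 :: complex:]"]
      by (simp add: o_def)
    also have "\<dots> = N" using that by simp
    finally show ?thesis .
  qed
  have Lkk: "poly (L k) (of_nat k) \<noteq> 0" for k
    by (auto simp: polyL)
  have Lkj: "poly (L k) (of_nat j) = 0" if "j \<noteq> k" "j \<le> N" for k j
    unfolding polyL by (rule prod_zero) (use that in auto)
  define c where "c k = poly (L k) w / poly (L k) (of_nat k)" for k
  have "(\<Sum>k\<le>N. c k * poly p (of_nat k)) = poly p w" if p: "degree p \<le> N" for p
  proof -
    define q where "q = (\<Sum>k\<le>N. smult (poly p (of_nat k) / poly (L k) (of_nat k)) (L k))"
    have "p = q"
    proof (rule poly_eqI_degree)
      fix x :: complex assume "x \<in> of_nat ` {..N}"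
      then obtain j where j: "j \<le> N" "x = of_nat j" by auto
      have "poly q x = (\<Sum>k\<le>N. if k = j then poly p (of_nat j) else 0)"
        unfolding q_def poly_sum using j Lkk Lkj by (intro sum.cong) auto
      also have "\<dots> = poly p x" using j by simp
      finally show "poly p x = poly q x" by simp
    next
      have cd: "card ((of_nat :: nat \<Rightarrow> complex) ` {..N}) = Suc N"
        by (subst card_image) (auto simp: inj_on_def)
      show "degree p < card ((of_nat :: nat \<Rightarrow> complex) ` {..N})" using p cd by simp
      have "degree q \<le> N" unfolding q_def
        by (intro degree_sum_le) (auto intro: order_trans[OF degree_smult_le] degL)
      then show "degree q < card ((of_nat :: nat \<Rightarrow> complex) ` {..N})" using cd by simp
    qed
    then have "poly p w = poly q w" by simp
    also have "\<dots> = (\<Sum>k\<le>N. c k * poly p (of_nat k))"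
      unfolding q_def poly_sum c_def by (intro sum.cong) auto
    finally show ?thesis by simp
  qed
  then show ?thesis using that by blast
qed

text \<open>On the disc of radius \<open>r / 2\<close> about a point of modulus at most \<open>r / 4\<close> the function is still bounded by 1,
so Cauchy's inequality bounds the derivative that appears in the Taylor remainder.\<close>

lemma taylor_remainder_bounded_holomorphic:
  fixes g :: "complex \<Rightarrow> complex"
  assumes hol: "g holomorphic_on ball 0 r" and r: "r > 0"
    and bd: "\<And>z. cmod z < r \<Longrightarrow> cmod (g z) \<le> 1"
    and z: "cmod z \<le> r / 4"
  shows "cmod (g z - (\<Sum>i\<le>N. (deriv ^^ i) g 0 * z ^ i / fact i))
    \<le> real (Suc N) * (2 / r) ^ Suc N * cmod z ^ Suc N"
proof -
  have "cmod ((deriv ^^ 0) g z - (\<Sum>i\<le>N. (deriv ^^ i) g 0 * (z - 0) ^ i / fact i))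
     \<le> (fact (Suc N) * 1 / (r/2) ^ Suc N) * cmod (z - 0) ^ Suc N / fact N"
  proof (rule complex_Taylor[where S = "cball 0 (r/4)" and f = "\<lambda>i. (deriv ^^ i) g"])
    fix i and x :: complex assume "x \<in> cball 0 (r/4)" "i \<le> N"
    then have "x \<in> ball 0 r" using r by auto
    then show "((deriv ^^ i) g has_field_derivative (deriv ^^ Suc i) g x) (at x within cball 0 (r/4))"
      using has_field_derivative_higher_deriv[OF hol] has_field_derivative_at_within by blast
  next
    fix x :: complex assume x: "x \<in> cball 0 (r/4)"
    have sub: "cball x (r/2) \<subseteq> ball 0 r"
    proof
      fix y assume "y \<in> cball x (r/2)"
      then have "cmod (y - x) \<le> r/2" by (simp add: dist_norm norm_minus_commute)
      moreover have "cmod x \<le> r/4" using x by simp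
      moreover have "cmod y \<le> cmod (y - x) + cmod x"
        by (metis diff_add_cancel norm_triangle_ineq)
      ultimately show "y \<in> ball 0 r" using r by simp
    qed
    show "cmod ((deriv ^^ Suc N) g x) \<le> fact (Suc N) * 1 / (r/2) ^ Suc N"
    proof (rule Cauchy_inequality)
      show "g holomorphic_on ball x (r/2)"
        using hol by (rule holomorphic_on_subset) (use sub ball_subset_cball in blast)
      show "continuous_on (cball x (r/2)) g"
        using hol sub holomorphic_on_imp_continuous_on continuous_on_subset by blast
      show "0 < r/2" using r by simp
      fix y assume "cmod (x - y) = r/2"
      then have "y \<in> ball 0 r" using sub by (auto simp: dist_norm)
      then show "cmod (g y) \<le> 1" using bd by simp
    qed
  qed (use r z in auto)
  also have "(fact (Suc N) * 1 / (r/2) ^ Suc N) * cmod (z - 0) ^ Suc N / fact N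
     = real (Suc N) * (2 / r) ^ Suc N * cmod z ^ Suc N"
    using r by (simp add: field_simps del: power_Suc)
  finally show ?thesis by simp
qed

text \<open>Interpolation is exact on the Taylor polynomial of degree \<open>N\<close>, so only the Taylor remainders at \<open>w\<close>
and at the nodes contribute. What matters later is the power \<open>r ^ Suc N\<close> in the denominator, with a
constant independent of \<open>g\<close> and \<open>r\<close>.\<close>

lemma interpolation_error_bounded_holomorphic:
  fixes w :: complex and c :: "nat \<Rightarrow> complex"
  assumes w: "cmod w \<le> 1"
    and c: "\<And>p. degree p \<le> N \<Longrightarrow> (\<Sum>k\<le>N. c k * poly p (of_nat k)) = poly p w"
  obtains K where "K > 0"
    and "\<And>g r. \<lbrakk>g holomorphic_on ball 0 r; r \<ge> 4 * real (Suc N); \<And>z. cmod z < r \<Longrightarrow> cmod (g z) \<le> 1\<rbrakk>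
           \<Longrightarrow> cmod (g w - (\<Sum>k\<le>N. c k * g (of_nat k))) \<le> K / r ^ Suc N"
proof
  let ?A = "real (Suc N) * 2 ^ Suc N"
  let ?K = "?A * (1 + (\<Sum>k\<le>N. cmod (c k) * real k ^ Suc N))"
  have "(\<Sum>k\<le>N. cmod (c k) * real k ^ Suc N) \<ge> 0" by (intro sum_nonneg) auto
  then show "?K > 0" by (intro mult_pos_pos) auto
  fix g :: "complex \<Rightarrow> complex" and r :: real
  assume hol: "g holomorphic_on ball 0 r" and r: "r \<ge> 4 * real (Suc N)"
    and bd: "\<And>z. cmod z < r \<Longrightarrow> cmod (g z) \<le> 1"
  have "0 < 4 * real (Suc N)" by simp
  also note r
  finally have r0: "r > 0" .
  define p where "p = (\<Sum>i\<le>N. monom ((deriv ^^ i) g 0 / fact i) i)"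
  have degp: "degree p \<le> N" unfolding p_def
    by (intro degree_sum_le) (auto intro: order_trans[OF degree_monom_le])
  have polyp: "poly p z = (\<Sum>i\<le>N. (deriv ^^ i) g 0 * z ^ i / fact i)" for z
    unfolding p_def by (simp add: poly_sum poly_monom)
  have err: "cmod (g z - poly p z) \<le> ?A / r ^ Suc N * cmod z ^ Suc N" if "cmod z \<le> real (Suc N)" for z
  proof -
    have "cmod z \<le> r / 4" using that r by simp
    from taylor_remainder_bounded_holomorphic[OF hol r0 bd this, of N]
    show ?thesis unfolding polyp by (simp add: power_divide)
  qed
  have "g w - (\<Sum>k\<le>N. c k * g (of_nat k))
      = (g w - poly p w) - (\<Sum>k\<le>N. c k * (g (of_nat k) - poly p (of_nat k)))"
    using c[OF degp] by (simp add: right_diff_distrib sum_subtractf)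
  also have "cmod \<dots> \<le> cmod (g w - poly p w) + cmod (\<Sum>k\<le>N. c k * (g (of_nat k) - poly p (of_nat k)))"
    by (rule norm_triangle_ineq4)
  also have "\<dots> \<le> ?A / r ^ Suc N * 1 + (\<Sum>k\<le>N. cmod (c k) * (?A / r ^ Suc N * real k ^ Suc N))"
  proof (intro add_mono sum_norm_le)
    have "cmod (g w - poly p w) \<le> ?A / r ^ Suc N * cmod w ^ Suc N" using err[of w] w by simp
    also have "\<dots> \<le> ?A / r ^ Suc N * 1"
      using w r0 by (intro mult_left_mono power_le_one) auto
    finally show "cmod (g w - poly p w) \<le> ?A / r ^ Suc N * 1" .
    fix k assume k: "k \<in> {..N}"
    have "cmod (g (of_nat k) - poly p (of_nat k)) \<le> ?A / r ^ Suc N * cmod (of_nat k) ^ Suc N"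
      by (rule err) (use k in simp)
    then show "cmod (c k * (g (of_nat k) - poly p (of_nat k))) \<le> cmod (c k) * (?A / r ^ Suc N * real k ^ Suc N)"
      unfolding norm_mult norm_of_nat by (rule mult_left_mono) simp
  qed
  also have "\<dots> = ?K / r ^ Suc N"
    by (simp only: sum_distrib_left ring_distribs add_divide_distrib sum_divide_distrib) (simp add: mult_ac)
  finally show "cmod (g w - (\<Sum>k\<le>N. c k * g (of_nat k))) \<le> ?K / r ^ Suc N" .
qed

section \<open>One-parameter groups of matrices\<close>

text \<open>Multiplication on the type of square matrices is componentwise, so the general theory of the
exponential function in Banach algebras does not apply to it. Bounded endomorphisms with composition and the
operator norm form a Banach algebra; there the exponential series, its functional equation and its
derivative are available, and the matrix exponential is read off in coordinates. The class
\<open>perfect_space\<close> below excludes the zero space, in which 0 = 1.\<close>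

typedef (overloaded) ('a::real_normed_vector) endo = "UNIV :: ('a \<Rightarrow>\<^sub>L 'a) set"
  morphisms blinfun_of_endo Endo by simp

setup_lifting type_definition_endo

instantiation endo :: (real_normed_vector) real_vector
begin
lift_definition zero_endo :: "'a endo" is 0 .
lift_definition plus_endo :: "'a endo \<Rightarrow> 'a endo \<Rightarrow> 'a endo" is "(+)" .
lift_definition minus_endo :: "'a endo \<Rightarrow> 'a endo \<Rightarrow> 'a endo" is "(-)" .
lift_definition uminus_endo :: "'a endo \<Rightarrow> 'a endo" is uminus .
lift_definition scaleR_endo :: "real \<Rightarrow> 'a endo \<Rightarrow> 'a endo" is scaleR .
instance by standard (transfer, simp add: algebra_simps)+
end

instantiation endo :: (real_normed_vector) real_normed_vector
begin
lift_definition norm_endo :: "'a endo \<Rightarrow> real" is norm .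
definition dist_endo :: "'a endo \<Rightarrow> 'a endo \<Rightarrow> real" where "dist_endo a b = norm (a - b)"
definition sgn_endo :: "'a endo \<Rightarrow> 'a endo" where "sgn_endo a = a /\<^sub>R norm a"
definition uniformity_endo :: "('a endo \<times> 'a endo) filter" where
  "uniformity_endo = (INF e\<in>{0<..}. principal {(x, y). dist x y < e})"
definition open_endo :: "'a endo set \<Rightarrow> bool" where
  "open_endo S = (\<forall>x\<in>S. \<forall>\<^sub>F (x', y) in uniformity. x' = x \<longrightarrow> y \<in> S)"
instance
proof
  fix a b :: "'a endo" and r :: real
  show "norm (a + b) \<le> norm a + norm b" by transfer (rule norm_triangle_ineq)
  show "norm a = 0 \<longleftrightarrow> a = 0" "norm (r *\<^sub>R a) = \<bar>r\<bar> * norm a" by (transfer, simp)+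
qed (simp_all add: dist_endo_def sgn_endo_def open_endo_def uniformity_endo_def)
end

instantiation endo :: ("{real_normed_vector, perfect_space}") real_normed_algebra_1
begin
lift_definition one_endo :: "'a endo" is id_blinfun .
lift_definition times_endo :: "'a endo \<Rightarrow> 'a endo \<Rightarrow> 'a endo" is blinfun_compose .
instance
proof
  fix a b c :: "'a endo" and r :: real
  show "a * b * c = a * (b * c)" by transfer (auto intro!: blinfun_eqI)
  show "1 * a = a" "a * 1 = a" by (transfer, auto intro!: blinfun_eqI)+
  show "(a + b) * c = a * c + b * c" "a * (b + c) = a * b + a * c"
    by (transfer, auto intro!: blinfun_eqI simp: blinfun.add_left blinfun.add_right)+
  show "(r *\<^sub>R a) * b = r *\<^sub>R (a * b)" "a * (r *\<^sub>R b) = r *\<^sub>R (a * b)"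
    by (transfer, auto intro!: blinfun_eqI simp: blinfun.scaleR_left blinfun.scaleR_right)+
  show "norm (a * b) \<le> norm a * norm b" by transfer (rule norm_blinfun_compose)
  show n1: "norm (1 :: 'a endo) = 1" by transfer (rule norm_blinfun_id)
  show "(0 :: 'a endo) \<noteq> 1" using n1 by (metis norm_zero zero_neq_one)
qed
end

lemma dist_blinfun_of_endo: "dist (blinfun_of_endo a) (blinfun_of_endo b) = dist a b"
  by (simp add: dist_norm norm_endo.rep_eq minus_endo.rep_eq)

instance endo :: ("{banach, perfect_space}") banach
proof
  fix X :: "nat \<Rightarrow> 'a endo" assume "Cauchy X"
  then have "Cauchy (\<lambda>n. blinfun_of_endo (X n))"
    by (simp add: Cauchy_def dist_blinfun_of_endo)
  then obtain l where l: "(\<lambda>n. blinfun_of_endo (X n)) \<longlonglongrightarrow> l"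
    using Cauchy_convergent_iff convergent_def by blast
  have "X \<longlonglongrightarrow> Endo l"
    using l by (simp add: tendsto_iff dist_blinfun_of_endo[symmetric] Endo_inverse)
  then show "convergent X" by (auto simp: convergent_def)
qed


definition endo_of_matrix :: "real ^ 'd ^ 'd \<Rightarrow> (real ^ 'd::finite) endo" where
  "endo_of_matrix A = Endo (Blinfun ((*v) A))"

definition matrix_of_endo :: "(real ^ 'd::finite) endo \<Rightarrow> real ^ 'd ^ 'd" where
  "matrix_of_endo T = matrix (blinfun_apply (blinfun_of_endo T))"

lemma linear_blinfun_of_endo: "linear (blinfun_apply (blinfun_of_endo T))"
  using blinfun.bounded_linear_right bounded_linear.linear by blast

text \<open>Continuity of the passage to coordinates is what allows it to be exchanged with the sum of the
exponential series.\<close>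

lemma bounded_linear_matrix_of_endo: "bounded_linear (matrix_of_endo :: (real ^ 'd::finite) endo \<Rightarrow> _)"
proof (rule bounded_linear_intro)
  fix S T :: "(real ^ 'd) endo" and r :: real
  show "matrix_of_endo (S + T) = matrix_of_endo S + matrix_of_endo T"
    by (simp add: matrix_of_endo_def matrix_def plus_endo.rep_eq blinfun.add_left vec_eq_iff)
  show "matrix_of_endo (r *\<^sub>R T) = r *\<^sub>R matrix_of_endo T"
    by (simp add: matrix_of_endo_def matrix_def scaleR_endo.rep_eq blinfun.scaleR_left vec_eq_iff)
  have entry: "norm (matrix_of_endo T $ i $ j) \<le> norm T" for i j
  proof -
    have "norm (matrix_of_endo T $ i $ j) \<le> norm (blinfun_apply (blinfun_of_endo T) (axis j 1))"
      unfolding matrix_of_endo_def matrix_def by (simp add: component_le_norm_cart)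
    also have "\<dots> \<le> norm (blinfun_of_endo T) * norm (axis j (1::real))"
      by (rule norm_blinfun)
    finally show ?thesis by (simp add: norm_endo.rep_eq)
  qed
  have "norm (matrix_of_endo T) \<le> (\<Sum>i\<in>UNIV. norm (matrix_of_endo T $ i))"
    unfolding norm_vec_def[of "matrix_of_endo T"] by (rule L2_set_le_sum) auto
  also have "\<dots> \<le> (\<Sum>i\<in>UNIV. \<Sum>j\<in>UNIV. norm (matrix_of_endo T $ i $ j))"
    by (intro sum_mono) (simp add: norm_vec_def L2_set_le_sum)
  also have "\<dots> \<le> (\<Sum>i\<in>(UNIV::'d set). \<Sum>j\<in>(UNIV::'d set). norm T)"
    by (intro sum_mono entry)
  finally show "norm (matrix_of_endo T) \<le> norm T * (real CARD('d) * real CARD('d))"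
    by (simp add: mult_ac)
qed

lemma matrix_of_endo_times: "matrix_of_endo (S * T) = matrix_of_endo S ** matrix_of_endo T"
  using matrix_compose[OF linear_blinfun_of_endo[of T] linear_blinfun_of_endo[of S]]
  by (simp add: matrix_of_endo_def times_endo.rep_eq blinfun_compose.rep_eq)

lemma matrix_of_endo_one: "matrix_of_endo 1 = mat 1"
  by (simp add: matrix_of_endo_def one_endo.rep_eq id_blinfun.rep_eq id_def[symmetric] matrix_id_mat_1)

lemma matrix_of_endo_of_matrix: "matrix_of_endo (endo_of_matrix A) = A"
  by (simp add: matrix_of_endo_def endo_of_matrix_def Endo_inverse
      bounded_linear_Blinfun_apply matrix_vector_mul_bounded_linear)

lemma endo_of_matrix_scaleR: "endo_of_matrix (s *\<^sub>R A) = s *\<^sub>R endo_of_matrix A"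
  unfolding endo_of_matrix_def
  by (rule iffD1[OF blinfun_of_endo_inject], rule blinfun_eqI)
    (simp add: scaleR_endo.rep_eq Endo_inverse bounded_linear_Blinfun_apply
      matrix_vector_mul_bounded_linear blinfun.scaleR_left scaleR_matrix_vector_assoc)

lemma matrix_of_endo_power: "matrix_of_endo (endo_of_matrix A ^ k) = matrix_power A k"
  by (induction k) (simp_all add: matrix_of_endo_one matrix_of_endo_times matrix_of_endo_of_matrix)

lemma matrix_exp_conv_exp: "matrix_exp A = matrix_of_endo (exp (endo_of_matrix A))"
proof -
  interpret bounded_linear "matrix_of_endo :: (real ^ 'a) endo \<Rightarrow> _"
    by (rule bounded_linear_matrix_of_endo)
  have "(\<lambda>k. matrix_of_endo (endo_of_matrix A ^ k /\<^sub>R fact k)) sums matrix_of_endo (exp (endo_of_matrix A))"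
    by (rule sums[OF exp_converges])
  then have "(\<lambda>k. (1 / fact k) *\<^sub>R matrix_power A k) sums matrix_of_endo (exp (endo_of_matrix A))"
    by (simp add: scaleR matrix_of_endo_power inverse_eq_divide)
  then show ?thesis unfolding matrix_exp_def by (simp add: sums_iff)
qed

lemma matrix_exp_zero: "matrix_exp (0 *\<^sub>R A) = mat 1"
  by (simp only: matrix_exp_conv_exp endo_of_matrix_scaleR) (simp add: matrix_of_endo_one)

lemma matrix_exp_add: "matrix_exp ((s + t) *\<^sub>R A) = matrix_exp (s *\<^sub>R A) ** matrix_exp (t *\<^sub>R A)"
  unfolding matrix_exp_conv_exp matrix_of_endo_times[symmetric] endo_of_matrix_scaleR
  unfolding scaleR_left_distrib by (subst exp_add_commuting) simp_all

lemma matrix_exp_has_vector_derivative: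
  "((\<lambda>s. matrix_exp (s *\<^sub>R A)) has_vector_derivative (matrix_exp (s *\<^sub>R A) ** A)) (at s)"
proof -
  interpret bounded_linear "matrix_of_endo :: (real ^ 'a) endo \<Rightarrow> _"
    by (rule bounded_linear_matrix_of_endo)
  have "((\<lambda>s. exp (s *\<^sub>R endo_of_matrix A)) has_vector_derivative
          exp (s *\<^sub>R endo_of_matrix A) * endo_of_matrix A) (at s)"
    by (rule exp_scaleR_has_vector_derivative_right)
  from has_vector_derivative[OF this] show ?thesis
    by (simp add: matrix_exp_conv_exp endo_of_matrix_scaleR matrix_of_endo_times matrix_of_endo_of_matrix)
qed

text \<open>The determinant turns the one-parameter group into a multiplicative function of \<open>s\<close>, so it is
determined by its derivative at 0. Differentiating the Leibniz expansion there, only the identity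
permutation survives, because any other permutation moves at least two points and so leaves an
off-diagonal factor, which vanishes at the identity matrix, undifferentiated. The identity permutation contributes the trace.\<close>

lemma det_matrix_exp: "det (matrix_exp (s *\<^sub>R A)) = exp (s * trace A)"
proof -
  define D where "D s = det (matrix_exp (s *\<^sub>R A))" for s
  have D_add: "D (s + t) = D s * D t" for s t
    by (simp add: D_def matrix_exp_add det_mul)
  have D0: "D 0 = 1" unfolding D_def matrix_exp_zero by (rule det_I)
  have entry: "((\<lambda>s. matrix_exp (s *\<^sub>R A) $ i $ j) has_real_derivative A $ i $ j) (at 0)" for i j
  proof -
    have "((\<lambda>s. matrix_exp (s *\<^sub>R A) $ i $ j) has_vector_derivative (matrix_exp (0 *\<^sub>R A) ** A) $ i $ j) (at 0)"
      by (intro bounded_linear.has_vector_derivative[OF bounded_linear_vec_nth]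
          matrix_exp_has_vector_derivative)
    then show ?thesis unfolding matrix_exp_zero matrix_mul_lid
      by (simp add: has_real_derivative_iff_has_vector_derivative)
  qed
  have "(D has_real_derivative
      (\<Sum>p | p permutes UNIV. of_int (sign p) * (\<Sum>i\<in>UNIV. A $ i $ p i *
         (\<Prod>j\<in>UNIV - {i}. matrix_exp (0 *\<^sub>R A) $ j $ p j)))) (at 0)"
    unfolding D_def[abs_def] det_def
    by (intro DERIV_sum DERIV_cmult has_field_derivative_prod entry)
  also have "(\<Sum>p | p permutes (UNIV::'a set). of_int (sign p) * (\<Sum>i\<in>UNIV. A $ i $ p i *
         (\<Prod>j\<in>UNIV - {i}. matrix_exp (0 *\<^sub>R A) $ j $ p j)))
      = (\<Sum>p | p permutes (UNIV::'a set). if p = id then trace A else 0)"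
  proof (rule sum.cong[OF refl])
    fix p :: "'a \<Rightarrow> 'a" assume "p \<in> {p. p permutes UNIV}"
    then have p: "p permutes UNIV" by simp
    show "of_int (sign p) * (\<Sum>i\<in>UNIV. A $ i $ p i *
         (\<Prod>j\<in>UNIV - {i}. matrix_exp (0 *\<^sub>R A) $ j $ p j)) = (if p = id then trace A else 0)"
    proof (cases "p = id")
      case True
      then show ?thesis unfolding matrix_exp_zero by (simp add: mat_def trace_def sign_id)
    next
      case False
      then obtain i0 where i0: "p i0 \<noteq> i0" by (auto simp: fun_eq_iff)
      have "(\<Prod>j\<in>UNIV - {i}. matrix_exp (0 *\<^sub>R A) $ j $ p j) = 0" for i
      proof -
        have "p (p i0) \<noteq> p i0" using i0 permutes_inj[OF p] by (auto dest: injD)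
        then obtain j where "j \<noteq> i" "p j \<noteq> j" using i0 by metis
        then show ?thesis unfolding matrix_exp_zero
          by (intro prod_zero) (auto simp: mat_def intro!: bexI[of _ j])
      qed
      then show ?thesis using False by (simp only: mult_zero_right sum.neutral_const if_False)
    qed
  qed
  also have "\<dots> = trace A" by (simp add: finite_permutations permutes_id)
  finally have D_deriv0: "(D has_real_derivative trace A) (at 0)" .
  have D_deriv: "(D has_real_derivative D s * trace A) (at s)" for s
  proof -
    have "((\<lambda>h. D s * D h) has_real_derivative D s * trace A) (at 0)"
      by (intro DERIV_cmult D_deriv0)
    then have "((\<lambda>h. D (s + h)) has_real_derivative D s * trace A) (at 0)"
      by (simp add: D_add)
    then show ?thesis
      using DERIV_shift[of D "D s * trace A" 0 s] by (simp add: add.commute)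
  qed
  have "\<exists>c. \<forall>s\<in>UNIV. D s * exp (- (s * trace A)) = c"
  proof (rule has_field_derivative_zero_constant)
    fix s :: real
    show "((\<lambda>s. D s * exp (- (s * trace A))) has_real_derivative 0) (at s within UNIV)"
      by (auto intro!: derivative_eq_intros D_deriv simp: algebra_simps)
  qed auto
  then obtain c where c: "\<And>s. D s * exp (- (s * trace A)) = c" by auto
  have "c = 1" using c[of 0] D0 by simp
  then have "D s = exp (s * trace A)" using c[of s] by (simp add: exp_minus field_simps)
  then show ?thesis by (simp add: D_def)
qed

lemma powr_matrix_one: "powr_matrix 1 E = mat 1"
  using matrix_exp_zero[of E] by (simp add: powr_matrix_def)

lemma powr_matrix_mult:
  "\<lbrakk>s > 0; t > 0\<rbrakk> \<Longrightarrow> powr_matrix (s * t) E = powr_matrix s E ** powr_matrix t E"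
  by (simp add: powr_matrix_def ln_mult matrix_exp_add)

lemma det_powr_matrix: "t > 0 \<Longrightarrow> det (powr_matrix t E) = t powr trace E"
  by (simp add: powr_matrix_def det_matrix_exp powr_def mult.commute)

lemma continuous_on_powr_matrix: "continuous_on {0<..} (\<lambda>t. powr_matrix t E)"
proof -
  have "continuous_on UNIV (\<lambda>s. matrix_exp (s *\<^sub>R E))"
    by (rule continuous_on_vector_derivative)
      (rule has_vector_derivative_at_within[OF matrix_exp_has_vector_derivative])
  then show ?thesis unfolding powr_matrix_def
    by (rule continuous_on_compose2) (auto intro!: continuous_intros)
qed

section \<open>Linear substitution and exponential decay in Lebesgue integrals\<close>

text \<open>A translation reduces to boxes with nonnegative lower corner in the direction \<open>n\<close>, for which the
invariance of volume under a shear is known.\<close>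

lemma measure_shear_cbox:
  fixes a b :: "real ^ 'd::finite"
  assumes mn: "m \<noteq> n"
  shows "measure lebesgue ((\<lambda>x. \<chi> i. if i = m then x$m + x$n else x$i) ` cbox a b)
       = measure lebesgue (cbox a b)"
proof (cases "cbox a b = {}")
  case False
  let ?h = "\<lambda>x :: real ^ 'd. \<chi> i. if i = m then x$m + x$n else x$i"
  define v :: "real ^ 'd" where "v = (\<chi> i. if i = n then - a $ n else 0)"
  have lin: "?h (x + y) = ?h x + ?h y" for x y
    by (simp add: vec_eq_iff)
  have "measure lebesgue (?h ` cbox a b) = measure lebesgue ((+) (?h v) ` ?h ` cbox a b)"
    by (rule measure_translation[symmetric])
  also have "(+) (?h v) ` ?h ` cbox a b = ?h ` cbox (v + a) (v + b)"
    unfolding cbox_translation image_image by (simp only: lin)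
  also have "measure lebesgue \<dots> = measure lebesgue (cbox (v + a) (v + b))"
    by (rule measure_shear_interval) (use mn False in \<open>auto simp: cbox_translation v_def\<close>)
  also have "\<dots> = measure lebesgue (cbox a b)"
    unfolding cbox_translation by (rule measure_translation)
  finally show ?thesis .
qed simp

text \<open>Preservation of the volume of boxes extends from boxes to bounded Borel sets, in particular to the
preimages of boxes, and these determine the image measure.\<close>

lemma lborel_distr_eqI:
  fixes h :: "'a::euclidean_space \<Rightarrow> 'a"
  assumes lin: "linear h"
    and meas: "\<And>a b. measure lebesgue (h ` cbox a b) = measure lebesgue (cbox a b)"
  shows "distr lborel borel h = lborel"
proof (rule lborel_eqI[symmetric])
  have h[measurable]: "h \<in> borel \<rightarrow>\<^sub>M borel"
    using lin by (intro borel_measurable_continuous_onI linear_continuous_on linear_conv_bounded_linear[THEN iffD1])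
  have inj: "inj h"
  proof -
    have "\<not> negligible (h ` cbox 0 (One::'a))"
      using meas[of 0 One] by (auto simp: negligible_iff_measure)
    then show ?thesis using lin negligible_linear_singular_image by blast
  qed
  then have surj: "surj h" using lin linear_injective_imp_surjective by blast
  fix l u :: 'a assume le: "\<And>b. b \<in> Basis \<Longrightarrow> l \<bullet> b \<le> u \<bullet> b"
  define S where "S = h -` box l u"
  have S_borel: "S \<in> sets borel" unfolding S_def using measurable_sets[OF h, of "box l u"] by simp
  have hS: "h ` S = box l u" unfolding S_def using surj by (rule surj_image_vimage_eq)
  obtain g where g: "linear g" "g \<circ> h = id" using linear_injective_left_inverse[OF lin inj] by blast
  have "S = g ` box l u" using g(2) hS
    by (metis image_comp image_id id_apply)
  then have "bounded S"
    using bounded_linear_image[OF bounded_box] g(1) linear_conv_bounded_linear by blast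
  then have S_lm: "S \<in> lmeasurable" using S_borel
    by (intro bounded_set_imp_lmeasurable) auto
  have "measure lebesgue S = measure lebesgue (box l u)"
    using measure_linear_sufficient[OF lin S_lm, of 1] meas hS by simp
  moreover have "emeasure lebesgue S = ennreal (measure lebesgue S)"
    using S_lm by (simp add: emeasure_eq_measure2)
  moreover have "emeasure lebesgue S = emeasure lborel S" using S_borel by simp
  ultimately have "emeasure lborel S = ennreal (measure lebesgue (box l u))" by simp
  also have "\<dots> = (\<Prod>b\<in>Basis. (u - l) \<bullet> b)"
    using le by (simp add: inner_diff_left)
  finally show "emeasure (distr lborel borel h) (box l u) = (\<Prod>b\<in>Basis. (u - l) \<bullet> b)"
    by (simp add: emeasure_distr S_def)
qed simp

lemma det_shear:
  fixes m n :: "'d::finite"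
  assumes "m \<noteq> n"
  shows "det ((\<chi> i j. of_bool (i = m \<and> j = n \<or> i = j)) :: real ^ 'd ^ 'd) = 1"
proof -
  have "((\<chi> i j. of_bool (i = m \<and> j = n \<or> i = j)) :: real ^ 'd ^ 'd)
      = (\<chi> k. if k = m then row m (mat 1) + 1 *s row n (mat 1) else row k (mat 1 :: real ^ 'd ^ 'd))"
    using assms by (auto simp: vec_eq_iff row_def mat_def)
  then show ?thesis using det_row_operation[OF assms, of "mat 1" 1] by (simp add: det_I)
qed

text \<open>The class of matrices with this property is closed under products, so it suffices to treat the
elementary ones: diagonal matrices scale each coordinate, while transpositions and shears preserve
Lebesgue measure.\<close>

lemma nn_integral_linear_substitution:
  fixes A :: "real ^ 'd ^ 'd::finite"
  shows "det A \<noteq> 0 \<longrightarrow> (\<forall>f\<in>borel_measurable borel.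
    (\<integral>\<^sup>+x. f x \<partial>lborel) = ennreal \<bar>det A\<bar> * (\<integral>\<^sup>+x. f (A *v x) \<partial>lborel))"
proof (induction A rule: induct_matrix_elementary_alt)
  case (1 A B)
  show ?case
  proof (intro impI ballI)
    fix f :: "real ^ 'd \<Rightarrow> ennreal" assume d: "det (A ** B) \<noteq> 0" and f[measurable]: "f \<in> borel_measurable borel"
    have [measurable]: "(\<lambda>x. A *v x) \<in> borel \<rightarrow>\<^sub>M borel"
      by (intro borel_measurable_continuous_onI matrix_vector_mult_linear_continuous_on)
    have "(\<lambda>x. f (A *v x)) \<in> borel_measurable borel" by measurable
    then show "(\<integral>\<^sup>+x. f x \<partial>lborel) = ennreal \<bar>det (A ** B)\<bar> * (\<integral>\<^sup>+x. f ((A ** B) *v x) \<partial>lborel)"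
      using 1 d f
      by (simp add: det_mul abs_mult ennreal_mult matrix_vector_mul_assoc[symmetric] mult.assoc)
  qed
next
  case (2 A i)
  then show ?case by (simp add: det_zero_row)
next
  case (3 A)
  show ?case
  proof (intro impI ballI)
    fix f :: "real ^ 'd \<Rightarrow> ennreal" assume d: "det A \<noteq> 0" and f[measurable]: "f \<in> borel_measurable borel"
    have detA: "det A = (\<Prod>i\<in>UNIV. A $ i $ i)" using 3 by (rule det_diagonal)
    have nz: "A $ i $ i \<noteq> 0" for i using d detA by auto
    define c where "c b = (\<Sum>i\<in>UNIV. A $ i $ i * b $ i)" for b :: "real ^ 'd"
    have c: "c (axis i 1) = A $ i $ i" for i by (simp add: c_def axis_def if_distrib cong: if_cong)
    have prodc: "(\<Prod>j\<in>Basis. \<bar>c j\<bar>) = \<bar>det A\<bar>"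
      by (simp add: Basis_vec_def detA abs_prod c prod.reindex[of "\<lambda>i. axis i 1"] inj_on_def axis_eq_axis image_image UNION_singleton_eq_range)
    have Ac: "(\<Sum>j\<in>Basis. (c j * (x \<bullet> j)) *\<^sub>R j) = A *v x" for x
    proof -
      have "(\<Sum>j\<in>Basis. (c j * (x \<bullet> j)) *\<^sub>R j) = (\<Sum>i\<in>UNIV. (A $ i $ i * x $ i) *\<^sub>R axis i 1)"
        by (simp add: Basis_vec_def c sum.reindex[of "\<lambda>i. axis i 1"] inj_on_def axis_eq_axis UNION_singleton_eq_range inner_axis)
      also have "\<dots> = A *v x"
      proof (rule vec_eq_iff[THEN iffD2], rule allI)
        fix i
        have "(A *v x) $ i = (\<Sum>j\<in>UNIV. if j = i then A $ i $ i * x $ i else 0)"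
          unfolding matrix_vector_mult_def vec_lambda_beta by (intro sum.cong) (use 3 in auto)
        then show "(\<Sum>i\<in>UNIV. (A $ i $ i * x $ i) *\<^sub>R axis i 1) $ i = (A *v x) $ i"
          by (simp add: axis_def if_distrib cong: if_cong)
      qed
      finally show ?thesis .
    qed
    have m: "(\<lambda>x. A *v x) \<in> borel \<rightarrow>\<^sub>M borel"
      by (intro borel_measurable_continuous_onI matrix_vector_mult_linear_continuous_on)
    have "c j \<noteq> 0" if "j \<in> Basis" for j using that nz by (auto simp: Basis_vec_def c)
    then have "lborel = density (distr lborel borel (\<lambda>x. A *v x)) (\<lambda>_. (\<Prod>j\<in>Basis. \<bar>c j\<bar>))"
      using lborel_affine_euclidean[of c 0] by (simp add: Ac)
    then have "(\<integral>\<^sup>+x. f x \<partial>lborel)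
       = (\<integral>\<^sup>+x. f x \<partial>density (distr lborel borel (\<lambda>x. A *v x)) (\<lambda>_. \<bar>det A\<bar>))"
      unfolding prodc by simp
    also have "\<dots> = ennreal \<bar>det A\<bar> * (\<integral>\<^sup>+x. f (A *v x) \<partial>lborel)"
      using m by (subst nn_integral_density) (auto simp: nn_integral_distr nn_integral_cmult)
    finally show "(\<integral>\<^sup>+x. f x \<partial>lborel) = ennreal \<bar>det A\<bar> * (\<integral>\<^sup>+x. f (A *v x) \<partial>lborel)" .
  qed
next
  case (4 m n)
  let ?A = "(\<chi> i j. mat 1 $ i $ Transposition.transpose m n j) :: real ^ 'd ^ 'd"
  let ?h = "\<lambda>v::real ^ 'd. \<chi> i. v $ Transposition.transpose m n i"
  have hA: "?A *v x = ?h x" for x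
  proof (rule vec_eq_iff[THEN iffD2], rule allI)
    fix i
    have "(?A *v x) $ i = (\<Sum>j\<in>UNIV. if j = Transposition.transpose m n i then x $ j else 0)"
    proof -
      have "i = Transposition.transpose m n j \<longleftrightarrow> j = Transposition.transpose m n i" for j
        by (metis transpose_involutory)
      then show ?thesis
        unfolding matrix_vector_mult_def vec_lambda_beta mat_def by (intro sum.cong) simp_all
    qed
    then show "(?A *v x) $ i = ?h x $ i" by simp
  qed
  have detA: "\<bar>det ?A\<bar> = 1"
    using 4 by (simp add: det_permute_columns permutes_swap_id sign_swap_id abs_mult)
  have lin: "linear ?h" by (rule linearI) (simp_all add: plus_vec_def scaleR_vec_def)
  have "distr lborel borel ?h = lborel"
  proof (rule lborel_distr_eqI[OF lin])
    fix a b :: "real ^ 'd"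
    show "measure lebesgue (?h ` cbox a b) = measure lebesgue (cbox a b)"
    proof (cases "cbox a b = {}")
      case False
      have eq: "?h ` cbox a b = cbox (?h a) (?h b)"
      proof
        show "cbox (?h a) (?h b) \<subseteq> ?h ` cbox a b"
        proof
          fix y assume y: "y \<in> cbox (?h a) (?h b)"
          have "a $ i \<le> ?h y $ i \<and> ?h y $ i \<le> b $ i" for i
            using y[unfolded mem_box_cart, rule_format, of "Transposition.transpose m n i"] by simp
          then have "?h y \<in> cbox a b" by (simp add: mem_box_cart)
          moreover have "y = ?h (?h y)" by (simp add: vec_eq_iff)
          ultimately show "y \<in> ?h ` cbox a b" by (rule image_eqI[rotated])
        qed
      qed (auto simp: mem_box_cart)
      then have "cbox (?h a) (?h b) \<noteq> {}" using False by auto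
      then show ?thesis
        using prod.permute[OF permutes_swap_id[of m UNIV n], of "\<lambda>i. b $ i - a $ i"] False
        by (simp add: eq content_cbox_cart o_def)
    qed simp
  qed
  then have "(\<integral>\<^sup>+x. f (?h x) \<partial>lborel) = (\<integral>\<^sup>+x. f x \<partial>lborel)" if "f \<in> borel_measurable borel" for f :: "_ \<Rightarrow> ennreal"
    using nn_integral_distr[of ?h lborel borel f] that lin
    by (simp add: borel_measurable_continuous_onI linear_continuous_on linear_conv_bounded_linear)
  then show ?case using detA by (simp add: hA)
next
  case (5 m n)
  let ?A = "(\<chi> i j. of_bool (i = m \<and> j = n \<or> i = j)) :: real ^ 'd ^ 'd"
  let ?h = "\<lambda>x::real ^ 'd. \<chi> i. if i = m then x$m + x$n else x$i"
  have hA: "?A *v x = ?h x" for x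
  proof (rule vec_eq_iff[THEN iffD2], rule allI)
    fix i
    have "(?A *v x) $ i = (\<Sum>j\<in>UNIV. (if j = i then x $ j else 0) + (if j = n then if i = m then x $ j else 0 else 0))"
      unfolding matrix_vector_mult_def vec_lambda_beta by (intro sum.cong) (use 5 in auto)
    then show "(?A *v x) $ i = ?h x $ i" by (simp add: sum.distrib)
  qed
  have lin: "linear ?h" by (rule linearI) (auto simp: vec_eq_iff algebra_simps)
  have "distr lborel borel ?h = lborel"
    by (rule lborel_distr_eqI[OF lin measure_shear_cbox[OF 5]])
  then have "(\<integral>\<^sup>+x. f (?h x) \<partial>lborel) = (\<integral>\<^sup>+x. f x \<partial>lborel)" if "f \<in> borel_measurable borel" for f :: "_ \<Rightarrow> ennreal"
    using nn_integral_distr[of ?h lborel borel f] that lin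
    by (simp add: borel_measurable_continuous_onI linear_continuous_on linear_conv_bounded_linear)
  then show ?case unfolding hA det_shear[OF 5] by simp
qed

lemma nn_integral_exp_neg_abs_finite:
  fixes a :: real
  assumes a: "a > 0"
  shows "(\<integral>\<^sup>+t. ennreal (exp (- (a * \<bar>t\<bar>))) \<partial>lborel) < \<infinity>"
proof -
  let ?h = "\<lambda>t::real. ennreal (exp (- (a * t))) * indicator {0..} t"
  have lim: "((\<lambda>t. - exp (- (a * t)) / a) \<longlongrightarrow> 0) at_top"
  proof -
    have "filterlim (\<lambda>t. - (a * t)) at_bot at_top"
      using a by (simp add: filterlim_uminus_at_bot filterlim_tendsto_pos_mult_at_top[OF tendsto_const] filterlim_ident)
    then have "((\<lambda>t. exp (- (a * t))) \<longlongrightarrow> 0) at_top"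
      by (rule filterlim_compose[OF exp_at_bot])
    then have "((\<lambda>t. - exp (- (a * t)) / a) \<longlongrightarrow> - 0 / a) at_top"
      by (intro tendsto_intros) (use a in auto)
    then show ?thesis by simp
  qed
  have h: "(\<integral>\<^sup>+t. ?h t \<partial>lborel) = ennreal (0 - (- exp (- (a * 0)) / a))"
    by (rule nn_integral_FTC_atLeast[OF _ _ _ lim])
      (use a in \<open>auto intro!: derivative_eq_intros\<close>)
  have "(\<integral>\<^sup>+t. ?h (- t) \<partial>lborel) = (\<integral>\<^sup>+t. ?h t \<partial>lborel)"
    using nn_integral_real_affine[of ?h "-1" 0] by simp
  moreover have "(\<integral>\<^sup>+t. ennreal (exp (- (a * \<bar>t\<bar>))) \<partial>lborel) \<le> (\<integral>\<^sup>+t. ?h t + ?h (- t) \<partial>lborel)"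
    by (intro nn_integral_mono) (auto simp: indicator_def abs_if)
  ultimately have "(\<integral>\<^sup>+t. ennreal (exp (- (a * \<bar>t\<bar>))) \<partial>lborel) \<le> (\<integral>\<^sup>+t. ?h t \<partial>lborel) + (\<integral>\<^sup>+t. ?h t \<partial>lborel)"
    by (simp add: nn_integral_add)
  also have "\<dots> < \<infinity>" unfolding h by simp
  finally show ?thesis .
qed

text \<open>Each coordinate is bounded by the norm, so the integrand is dominated by a product of
one-dimensional exponentials.\<close>

lemma nn_integral_exp_neg_norm_finite:
  fixes c :: real
  assumes c: "c > 0"
  shows "(\<integral>\<^sup>+(x::'a::euclidean_space). ennreal (exp (- (c * norm x))) \<partial>lborel) < \<infinity>"
proof -
  define a where "a = c / DIM('a)"
  have a: "a > 0" using c by (simp add: a_def)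
  have "exp (- (c * norm x)) \<le> (\<Prod>b\<in>Basis. exp (- (a * \<bar>x \<bullet> b\<bar>)))" for x :: 'a
  proof -
    have "(\<Sum>b\<in>Basis. a * \<bar>x \<bullet> b\<bar>) \<le> (\<Sum>b\<in>(Basis::'a set). a * norm x)"
      using a by (intro sum_mono mult_left_mono Basis_le_norm) auto
    also have "\<dots> = c * norm x" by (simp add: a_def)
    finally show ?thesis by (simp add: exp_sum[symmetric] sum_negf)
  qed
  then have "(\<integral>\<^sup>+(x::'a). ennreal (exp (- (c * norm x))) \<partial>lborel)
      \<le> (\<integral>\<^sup>+(x::'a). (\<Prod>b\<in>Basis. ennreal (exp (- (a * \<bar>x \<bullet> b\<bar>)))) \<partial>lborel)"
    by (intro nn_integral_mono) (simp add: prod_ennreal ennreal_leI)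
  also have "\<dots> = (\<Prod>b\<in>(Basis::'a set). \<integral>\<^sup>+t. ennreal (exp (- (a * \<bar>t\<bar>))) \<partial>lborel)"
    by (rule nn_integral_lborel_prod) auto
  also have "\<dots> < \<infinity>"
    using nn_integral_exp_neg_abs_finite[OF a]
    by (cases "\<integral>\<^sup>+t. ennreal (exp (- (a * \<bar>t\<bar>))) \<partial>lborel" rule: ennreal_cases) (auto simp: ennreal_power)
  finally show ?thesis .
qed

text \<open>The gap on the part of the torus away from the maxima yields exponential decay; this is absorbed into the power of \<open>n\<close>.\<close>

lemma exp_decay_le_powr:
  fixes \<kappa> \<mu> :: real
  assumes \<kappa>: "\<kappa> > 0"
  obtains C where "C > 0" "\<And>n. n \<ge> 1 \<Longrightarrow> exp (- (\<kappa> * n)) \<le> C * n powr (- \<mu>)"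
proof -
  (* The slope \<eta> is so small that |\<mu>| ln n \<le> |\<mu>| (\<eta> n - ln \<eta>) stays below \<kappa> n up to a constant. *)
  define \<eta> where "\<eta> = \<kappa> / (\<bar>\<mu>\<bar> + 1)"
  have \<eta>: "\<eta> > 0" "\<bar>\<mu>\<bar> * \<eta> \<le> \<kappa>" using \<kappa> by (auto simp: \<eta>_def field_simps)
  have "exp (- (\<kappa> * n)) \<le> exp (- (\<bar>\<mu>\<bar> * ln \<eta>)) * n powr (- \<mu>)" if n: "n \<ge> 1" for n
  proof -
    have "ln (\<eta> * n) \<le> \<eta> * n - 1" using \<eta> n by (intro ln_le_minus_one) auto
    then have "ln n + ln \<eta> \<le> \<eta> * n" using \<eta> n by (simp add: ln_mult)
    then have "\<bar>\<mu>\<bar> * (ln n + ln \<eta>) \<le> \<bar>\<mu>\<bar> * (\<eta> * n)" by (intro mult_left_mono) auto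
    also have "\<dots> = (\<bar>\<mu>\<bar> * \<eta>) * n" by simp
    also have "\<dots> \<le> \<kappa> * n" using \<eta> n by (intro mult_right_mono) auto
    finally have "\<bar>\<mu>\<bar> * ln n + \<bar>\<mu>\<bar> * ln \<eta> \<le> \<kappa> * n" by (simp add: algebra_simps)
    moreover have "\<mu> * ln n \<le> \<bar>\<mu>\<bar> * ln n" using n by (intro mult_right_mono) auto
    ultimately have "- (\<kappa> * n) \<le> - (\<bar>\<mu>\<bar> * ln \<eta>) + - \<mu> * ln n" by linarith
    then have "exp (- (\<kappa> * n)) \<le> exp (- (\<bar>\<mu>\<bar> * ln \<eta>) + - \<mu> * ln n)" by simp
    then show ?thesis using n by (simp add: powr_def exp_add[symmetric])
  qed
  then show ?thesis using that[of "exp (- (\<bar>\<mu>\<bar> * ln \<eta>))"] by simp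
qed

section \<open>Positive definite functions homogeneous under a linear flow\<close>

text \<open>The setting for everything that concerns the symbol alone: \<open>R\<close> is the real part of \<open>P\<close>
and \<open>T t\<close> is the linear map given by the matrix power of \<open>t\<close>, for which \<open>R\<close> has weight one.\<close>

locale homogeneous_flow =
  fixes R :: "'a::euclidean_space \<Rightarrow> real" and T :: "real \<Rightarrow> 'a \<Rightarrow> 'a"
  assumes continuous_R: "continuous_on UNIV R"
    and R_nonneg: "R x \<ge> 0"
    and R_eq_0D: "R x = 0 \<Longrightarrow> x = 0"
    and linear_T: "t > 0 \<Longrightarrow> linear (T t)"
    and T_one: "T 1 x = x"
    and T_mult: "\<lbrakk>s > 0; t > 0\<rbrakk> \<Longrightarrow> T (s * t) x = T s (T t x)"
    and continuous_T: "continuous_on {0<..} (\<lambda>t. T t x)"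
    and R_T: "t > 0 \<Longrightarrow> R (T t x) = t * R x"
begin

lemma T_0: "t > 0 \<Longrightarrow> T t 0 = 0"
  using linear_T linear_0 by blast

lemma R_0: "R 0 = 0"
  using R_T[of 2 0] T_0[of 2] by simp

lemma R_pos: "x \<noteq> 0 \<Longrightarrow> R x > 0"
  using R_nonneg[of x] R_eq_0D[of x] by force

lemma T_inverse: "t > 0 \<Longrightarrow> T t (T (1 / t) x) = x"
  using T_mult[of t "1 / t" x] by (simp add: T_one)

lemma T_scaleR: "t > 0 \<Longrightarrow> T t (s *\<^sub>R x) = s *\<^sub>R T t x"
  using linear_T linear_scale by blast

lemma crosses_sphere:
  assumes t: "0 < t" "t \<le> 1"
    and "norm x \<le> \<delta> \<and> \<delta> \<le> norm (T t x) \<or> norm (T t x) \<le> \<delta> \<and> \<delta> \<le> norm x"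
  shows "\<exists>s. 0 < s \<and> s \<le> 1 \<and> norm (T s x) = \<delta>"
proof -
  have c: "continuous_on {t..1} (\<lambda>s. norm (T s x))"
    using t by (intro continuous_intros continuous_on_subset[OF continuous_T]) auto
  from assms(3) have "\<exists>s\<ge>t. s \<le> 1 \<and> norm (T s x) = \<delta>"
  proof
    assume "norm x \<le> \<delta> \<and> \<delta> \<le> norm (T t x)"
    then show ?thesis using IVT2'[OF _ _ t(2) c, of \<delta>] by (auto simp: T_one)
  next
    assume "norm (T t x) \<le> \<delta> \<and> \<delta> \<le> norm x"
    then show ?thesis using IVT'[OF _ _ t(2) c, of \<delta>] by (auto simp: T_one)
  qed
  then obtain s where s: "t \<le> s" "s \<le> 1" "norm (T s x) = \<delta>" by blast
  have "0 < s" using s t by linarith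
  then show ?thesis using s by blast
qed

text \<open>Let \<open>c\<close> be the minimum of \<open>R\<close> on the sphere of radius \<open>\<delta>\<close>. Along an orbit \<open>R\<close> shrinks as \<open>t\<close> decreases, so an
orbit starting at a point where \<open>R < c\<close> can never cross the sphere for \<open>t \<le> 1\<close>. Orbits that start
close to 0 therefore remain inside, and by linearity all the maps \<open>T t\<close> with \<open>t \<le> 1\<close> are uniformly bounded.
An orbit starting outside the sphere with \<open>R < c\<close> would thus be confined to a compact annulus
while \<open>R\<close> tends to 0 along it as \<open>t\<close> tends to 0, which contradicts positivity.\<close>

lemma R_bounded_below_outside_ball:
  assumes \<delta>: "\<delta> > 0"
  obtains c where "c > 0" "\<And>x. norm x \<ge> \<delta> \<Longrightarrow> R x \<ge> c"
proof -
  have contR: "continuous_on S R" for S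
    using continuous_R continuous_on_subset by blast
  have "sphere (0::'a) \<delta> \<noteq> {}" using \<delta> by simp
  then obtain m where m: "m \<in> sphere 0 \<delta>" "\<And>y. y \<in> sphere 0 \<delta> \<Longrightarrow> R m \<le> R y"
    using continuous_attains_inf[OF compact_sphere _ contR] by blast
  define c where "c = R m"
  have "m \<noteq> 0" using m \<delta> by auto
  then have c: "c > 0" unfolding c_def by (rule R_pos)
  have c_sphere: "R y \<ge> c" if "norm y = \<delta>" for y
    using m that by (simp add: c_def)
  have no_cross: "norm (T s y) \<noteq> \<delta>" if "R y < c" "0 < s" "s \<le> 1" for s y
  proof
    assume "norm (T s y) = \<delta>"
    then have "c \<le> s * R y" using c_sphere R_T that by metis
    also have "\<dots> \<le> R y" using that R_nonneg[of y] by (simp add: mult_left_le_one_le)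
    finally show False using that by simp
  qed
  have "\<exists>\<rho>>0. \<forall>y. norm y < \<rho> \<longrightarrow> R y < c"
  proof -
    have "isCont R 0" using continuous_R by (simp add: continuous_on_eq_continuous_at)
    then obtain \<rho> where "\<rho> > 0" "\<And>y. dist y 0 < \<rho> \<Longrightarrow> dist (R y) (R 0) < c"
      using c unfolding continuous_at_eps_delta dist_norm by metis
    then show ?thesis using R_0 by (intro exI[of _ \<rho>]) (force simp: dist_real_def)
  qed
  then obtain \<rho>0 where \<rho>0: "\<rho>0 > 0" "\<And>y. norm y < \<rho>0 \<Longrightarrow> R y < c" by blast
  define \<rho> where "\<rho> = min \<rho>0 \<delta> / 2"
  have \<rho>: "\<rho> > 0" "\<rho> < \<delta>" "\<rho> < \<rho>0" using \<rho>0(1) \<delta> by (auto simp: \<rho>_def)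
  (* Rescale y into the small ball where orbits cannot escape. *)
  have bound: "norm (T t y) \<le> \<delta> / \<rho> * norm y" if t: "0 < t" "t \<le> 1" for t y
  proof (cases "y = 0")
    case True then show ?thesis using t T_0 by simp
  next
    case False
    define z where "z = (\<rho> / norm y) *\<^sub>R y"
    have nz: "norm z = \<rho>" using False \<rho> by (simp add: z_def)
    then have "R z < c" using \<rho> \<rho>0 by simp
    then have "\<not> \<delta> \<le> norm (T t z)"
      using crosses_sphere[OF t, of z \<delta>] no_cross[of z] nz \<rho> by auto
    moreover have "norm (T t z) = \<rho> / norm y * norm (T t y)"
      using \<rho> t by (simp add: z_def T_scaleR)
    ultimately show ?thesis using False \<rho> by (simp add: field_simps)
  qed
  have "R x \<ge> c" if x: "norm x \<ge> \<delta>" for x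
  proof (rule ccontr)
    assume "\<not> c \<le> R x"
    then have Rx: "R x < c" by simp
    have out: "norm (T t x) \<ge> \<delta>" if "0 < t" "t \<le> 1" for t
      using crosses_sphere[OF that, of x \<delta>] no_cross[OF Rx] x by force
    let ?S = "cball (0::'a) (\<delta> / \<rho> * norm x) \<inter> - ball 0 \<delta>"
    have inS: "T t x \<in> ?S" if "0 < t" "t \<le> 1" for t
      using out[OF that] bound[OF that] by simp
    have "compact ?S" by (intro compact_Int_closed) auto
    moreover have "?S \<noteq> {}" using inS[of 1] by auto
    ultimately obtain m2 where m2: "m2 \<in> ?S" "\<And>y. y \<in> ?S \<Longrightarrow> R m2 \<le> R y"
      using continuous_attains_inf[OF _ _ contR] by metis
    have "m2 \<noteq> 0" using m2 \<delta> by auto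
    then have R2: "R m2 > 0" by (rule R_pos)
    have "x \<noteq> 0" using x \<delta> by auto
    then have Rx0: "R x > 0" by (rule R_pos)
    define t where "t = min 1 (R m2 / (2 * R x))"
    have t: "0 < t" "t \<le> 1" using R2 Rx0 by (auto simp: t_def)
    have "R m2 \<le> t * R x" using m2(2)[OF inS[OF t]] R_T[OF t(1)] by simp
    also have "\<dots> \<le> R m2 / (2 * R x) * R x"
      using Rx0 by (intro mult_right_mono) (auto simp: t_def)
    also have "\<dots> < R m2" using R2 Rx0 by simp
    finally show False by simp
  qed
  then show ?thesis using c that by blast
qed

lemma sublevel_bounded:
  assumes r: "r > 0"
  obtains B where "B > 0" "\<And>x. R x \<le> r \<Longrightarrow> norm x \<le> B"
proof -
  obtain c where c: "c > 0" "\<And>x. norm x \<ge> 1 \<Longrightarrow> R x \<ge> c"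
    using R_bounded_below_outside_ball[of 1] by auto
  define t where "t = 2 * r / c"
  have t: "t > 0" using r c by (simp add: t_def)
  obtain B where B: "B > 0" "\<And>x. norm (T t x) \<le> B * norm x"
    using linear_bounded_pos[OF linear_T[OF t]] by blast
  have "norm x \<le> B" if "R x \<le> r" for x
  proof -
    have "R (T (1/t) x) \<le> c / 2"
    proof -
      have "R (T (1/t) x) = R x / t" using R_T[of "1/t" x] t by simp
      also have "\<dots> \<le> r / t" using that t by (simp add: divide_right_mono)
      also have "\<dots> = c / 2" using r c by (simp add: t_def)
      finally show ?thesis .
    qed
    then have "norm (T (1/t) x) \<le> 1" using c by (smt (verit) field_sum_of_halves)
    then have "B * norm (T (1/t) x) \<le> B * 1" using B(1) by (intro mult_left_mono) auto
    then show ?thesis using B(2)[of "T (1/t) x"] T_inverse[OF t, of x] by simp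
  qed
  then show ?thesis using B(1) that by blast
qed

text \<open>Some \<open>T q\<close> with \<open>q < 1\<close> halves the norm, so \<open>T (q ^ k)\<close> divides it by \<open>2 ^ k\<close>, while it multiplies
\<open>R\<close> by \<open>q ^ k\<close>. Comparing the two rates shows that \<open>R\<close> vanishes at 0 to finite order at most. This
makes high powers of the norm negligible against \<open>R\<close> near 0.\<close>

lemma norm_power_le_R:
  obtains N K where "N > 0" "K > 0" "\<And>x. R x \<le> 1 \<Longrightarrow> norm x ^ N \<le> K * R x"
proof -
  obtain B where B: "B > 0" "\<And>x. R x \<le> 1 \<Longrightarrow> norm x \<le> B"
    using sublevel_bounded[of 1] by auto
  obtain c where c: "c > 0" "\<And>x. norm x \<ge> 1/2 \<Longrightarrow> R x \<ge> c"
    using R_bounded_below_outside_ball[of "1/2"] by auto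
  have "sphere (0::'a) 1 \<noteq> {}" by simp
  then obtain m where m: "m \<in> sphere 0 1" "\<And>y. y \<in> sphere 0 1 \<Longrightarrow> R y \<le> R m"
    using continuous_attains_sup[OF compact_sphere _ continuous_on_subset[OF continuous_R]] by blast
  have "m \<noteq> 0" using m by auto
  then have Rm: "R m > 0" by (rule R_pos)
  define q where "q = min (1/2) (c / (2 * R m))"
  have q: "q > 0" "q < 1" using c Rm by (auto simp: q_def)
  have halve: "norm (T q x) \<le> norm x / 2" for x
  proof (cases "x = 0")
    case True then show ?thesis using q T_0 by simp
  next
    case False
    define z where "z = (1 / norm x) *\<^sub>R x"
    have nz: "norm z = 1" using False by (simp add: z_def)
    have "R (T q z) = q * R z" by (rule R_T[OF q(1)])
    also have "\<dots> \<le> c / (2 * R m) * R m"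
      using m(2)[of z] nz R_nonneg[of z] c Rm by (intro mult_mono) (auto simp: q_def)
    also have "\<dots> < c" using Rm c by simp
    finally have "norm (T q z) < 1/2" using c(2)[of "T q z"] by linarith
    moreover have "norm (T q z) = norm (T q x) / norm x" using q by (simp add: z_def T_scaleR)
    ultimately show ?thesis using False by (simp add: field_simps)
  qed
  have iter: "norm (T (q ^ k) x) \<le> norm x * (1/2) ^ k" for k x
  proof (induction k)
    case 0 then show ?case by (simp add: T_one)
  next
    case (Suc k)
    have "norm (T (q ^ Suc k) x) = norm (T q (T (q ^ k) x))" using T_mult[of q "q ^ k"] q by simp
    also have "\<dots> \<le> norm (T (q ^ k) x) / 2" by (rule halve)
    also have "\<dots> \<le> norm x * (1/2) ^ Suc k" using Suc by simp
    finally show ?case .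
  qed
  (* Each step multiplies R by q, and the N-th power of the norm by at most 1/2 ^ N, which is less than q. *)
  obtain N where N: "(1/2::real) ^ N < q" using real_arch_pow_inv[OF q(1), of "1/2"] by auto
  have N0: "N > 0" using N q by (cases N) auto
  have "norm x ^ N \<le> B ^ N / q * R x" if x1: "R x \<le> 1" for x
  proof (cases "x = 0")
    case True then show ?thesis using N0 R_0 by (simp add: power_0_left)
  next
    case False
    then have Rx: "R x > 0" by (rule R_pos)
    (* k is the scale of x: R x lies between q ^ Suc k and q ^ k. *)
    define k where "k = (LEAST k. q ^ Suc k < R x)"
    have "\<exists>k. q ^ Suc k < R x"
    proof -
      obtain k where k: "q ^ k < R x" using real_arch_pow_inv[OF Rx q(2)] by blast
      have "q ^ Suc k \<le> q ^ k" using q by (intro power_decreasing) auto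
      then have "q ^ Suc k < R x" using k by linarith
      then show ?thesis by blast
    qed
    then have k1: "q ^ Suc k < R x" unfolding k_def by (rule LeastI_ex)
    have k2: "R x \<le> q ^ k"
    proof (cases k)
      case 0 then show ?thesis using x1 by simp
    next
      case (Suc j)
      then have "\<not> q ^ Suc j < R x" using not_less_Least[of j "\<lambda>k. q ^ Suc k < R x"] by (simp add: k_def)
      then show ?thesis using Suc by simp
    qed
    have qk: "q ^ k > 0" using q by simp
    define y where "y = T (1 / q ^ k) x"
    have "R y \<le> 1" using R_T[of "1 / q ^ k" x] qk k2 by (simp add: y_def)
    then have yB: "norm y \<le> B" by (rule B(2))
    have "norm x = norm (T (q ^ k) y)" unfolding y_def by (subst T_inverse[OF qk]) simp
    also have "\<dots> \<le> norm y * (1/2) ^ k" by (rule iter)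
    also have "\<dots> \<le> B * (1/2) ^ k" using yB by (intro mult_right_mono) auto
    finally have "norm x ^ N \<le> (B * (1/2) ^ k) ^ N" by (intro power_mono) auto
    also have "\<dots> = B ^ N * ((1/2) ^ N) ^ k"
      by (simp add: power_mult_distrib power_mult[symmetric] mult.commute)
    also have "\<dots> \<le> B ^ N * q ^ k"
      using N B(1) by (intro mult_left_mono power_mono) auto
    also have "\<dots> \<le> B ^ N * (R x / q)"
      using k1 q B(1) by (intro mult_left_mono) (auto simp: field_simps)
    finally show ?thesis by simp
  qed
  moreover have "B ^ N / q > 0" using B(1) q by simp
  ultimately show ?thesis using N0 that by blast
qed

lemma compact_unit_level: "compact {p. R (fst p) + R (snd p) = 1}"
proof -
  obtain B where B: "B > 0" "\<And>x. R x \<le> 1 \<Longrightarrow> norm x \<le> B"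
    using sublevel_bounded[of 1] by auto
  have "continuous_on UNIV (\<lambda>p :: 'a \<times> 'a. R (fst p))" "continuous_on UNIV (\<lambda>p :: 'a \<times> 'a. R (snd p))"
    by (rule continuous_on_compose2[OF continuous_R]; auto intro!: continuous_on_fst continuous_on_snd continuous_on_id)+
  then have "continuous_on UNIV (\<lambda>p :: 'a \<times> 'a. R (fst p) + R (snd p))"
    by (rule continuous_on_add)
  from closed_Collect_eq[OF this continuous_on_const] have "closed {p. R (fst p) + R (snd p) = 1}" .
  moreover have sub: "{p. R (fst p) + R (snd p) = 1} \<subseteq> cball 0 B \<times> cball 0 B"
  proof
    fix p assume "p \<in> {p. R (fst p) + R (snd p) = 1}"
    then have "R (fst p) \<le> 1" "R (snd p) \<le> 1"
      using R_nonneg[of "fst p"] R_nonneg[of "snd p"] by auto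
    then show "p \<in> cball 0 B \<times> cball 0 B" using B(2) by (cases p) auto
  qed
  moreover have "compact (cball (0::'a) B \<times> cball (0::'a) B)" by (intro compact_Times compact_cball)
  ultimately have "compact ((cball 0 B \<times> cball 0 B) \<inter> {p. R (fst p) + R (snd p) = 1})"
    by (intro compact_Int_closed)
  then show ?thesis using sub by (simp only: Int_absorb1)
qed

text \<open>Two functions of weight one need only be compared on the unit level set, which is compact; this is
the source of all the uniform constants below.\<close>

lemma homogeneous_le:
  assumes hom: "\<And>t x y. t > 0 \<Longrightarrow> F (T t x) (T t y) = t * F x y"
    and homG: "\<And>t x y. t > 0 \<Longrightarrow> G (T t x) (T t y) = t * G x y"
    and unit: "\<And>x y. R x + R y = 1 \<Longrightarrow> F x y \<le> (G x y :: real)"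
  shows "F x y \<le> G x y"
proof (cases "R x + R y = 0")
  case True
  then have "x = 0" "y = 0" using R_nonneg[of x] R_nonneg[of y] R_eq_0D by auto
  moreover have "F 0 0 = 0" "G 0 0 = 0" using hom[of 2 0 0] homG[of 2 0 0] T_0[of 2] by auto
  ultimately show ?thesis by simp
next
  case False
  define r where "r = R x + R y"
  have r: "r > 0" using False R_nonneg[of x] R_nonneg[of y] by (simp add: r_def)
  have "R (T (1/r) x) + R (T (1/r) y) = 1"
    using r by (simp add: R_T r_def add_divide_distrib[symmetric])
  then have "F (T (1/r) x) (T (1/r) y) \<le> G (T (1/r) x) (T (1/r) y)" by (rule unit)
  then show ?thesis using r by (simp add: hom homG divide_le_cancel)
qed

lemma homogeneous_bound:
  assumes cont: "continuous_on UNIV (\<lambda>p. F (fst p) (snd p))"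
    and hom: "\<And>t x y. t > 0 \<Longrightarrow> F (T t x) (T t y) = t * (F x y :: real)"
  obtains C where "C > 0" "\<And>x y. \<bar>F x y\<bar> \<le> C * (R x + R y)"
proof -
  let ?S = "{p. R (fst p) + R (snd p) = 1}"
  have "compact ((\<lambda>p. F (fst p) (snd p)) ` ?S)"
    using compact_continuous_image[OF continuous_on_subset[OF cont] compact_unit_level] by blast
  then have "bounded ((\<lambda>p. F (fst p) (snd p)) ` ?S)" by (rule compact_imp_bounded)
  then obtain C where C: "C > 0" "\<And>p. p \<in> ?S \<Longrightarrow> \<bar>F (fst p) (snd p)\<bar> \<le> C"
    unfolding bounded_pos by auto
  have "\<bar>F x y\<bar> \<le> C * (R x + R y)" for x y
  proof (rule homogeneous_le[where F = "\<lambda>x y. \<bar>F x y\<bar>" and G = "\<lambda>x y. C * (R x + R y)"])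
    fix x y assume "R x + R y = 1"
    then show "\<bar>F x y\<bar> \<le> C * (R x + R y)" using C(2)[of "(x, y)"] by simp
  qed (simp_all add: hom R_T abs_mult algebra_simps)
  then show ?thesis using C(1) that by blast
qed

text \<open>This will be applied to the real part of \<open>P\<close> at complex frequencies \<open>x - \<i> y\<close>, which equals \<open>R x\<close> for \<open>y = 0\<close>.
On the part of the unit level set where \<open>F\<close> falls below half of \<open>R x\<close>, compactness keeps \<open>R y\<close> away from 0, so
a large multiple of \<open>R y\<close> compensates.\<close>

lemma homogeneous_lower_bound:
  assumes cont: "continuous_on UNIV (\<lambda>p. F (fst p) (snd p))"
    and hom: "\<And>t x y. t > 0 \<Longrightarrow> F (T t x) (T t y) = t * (F x y :: real)"
    and F0: "\<And>x. F x 0 = R x"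
  obtains M where "M > 0" "\<And>x y. R x / 2 - M * R y \<le> F x y"
proof -
  obtain C where C: "C > 0" "\<And>x y. \<bar>F x y\<bar> \<le> C * (R x + R y)"
    using homogeneous_bound[of F, OF cont hom] by metis
  let ?S = "{p. R (fst p) + R (snd p) = 1} \<inter> {p. F (fst p) (snd p) \<le> R (fst p) / 2}"
  have "continuous_on UNIV (\<lambda>p :: 'a \<times> 'a. R (fst p))"
    by (rule continuous_on_compose2[OF continuous_R]) (auto intro!: continuous_on_fst continuous_on_snd continuous_on_id)
  then have "continuous_on UNIV (\<lambda>p :: 'a \<times> 'a. R (fst p) / 2)"
    by (intro continuous_intros) auto
  with cont have "closed {p. F (fst p) (snd p) \<le> R (fst p) / 2}" by (rule closed_Collect_le)
  with compact_unit_level have cS: "compact ?S" by (rule compact_Int_closed)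
  have posS: "R (snd p) > 0" if "p \<in> ?S" for p
  proof (rule ccontr)
    assume "\<not> 0 < R (snd p)"
    then have "R (snd p) = 0" using R_nonneg[of "snd p"] by simp
    then have "snd p = 0" "R (fst p) = 1" using R_eq_0D that by auto
    then show False using that F0[of "fst p"] by simp
  qed
  have "\<exists>c>0. \<forall>p\<in>?S. R (snd p) \<ge> c"
  proof (cases "?S = {}")
    case True then show ?thesis by (auto intro: exI[of _ 1])
  next
    case False
    have "continuous_on ?S (\<lambda>p. R (snd p))"
      by (rule continuous_on_compose2[OF continuous_R]) (auto intro!: continuous_on_fst continuous_on_snd continuous_on_id)
    then obtain m where "m \<in> ?S" "\<And>y. y \<in> ?S \<Longrightarrow> R (snd m) \<le> R (snd y)"
      using continuous_attains_inf[OF cS False] by blast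
    then show ?thesis using posS by blast
  qed
  then obtain c where c: "c > 0" "\<And>p. p \<in> ?S \<Longrightarrow> R (snd p) \<ge> c" by blast
  define M where "M = (C + 1) / c"
  have M: "M > 0" using C c by (simp add: M_def)
  have "R x / 2 - M * R y \<le> F x y" for x y
  proof (rule homogeneous_le[where F = "\<lambda>x y. R x / 2 - M * R y" and G = F])
    fix x y assume 1: "R x + R y = 1"
    have y0: "M * R y \<ge> 0" using M R_nonneg by simp
    show "R x / 2 - M * R y \<le> F x y"
    proof (cases "F x y \<le> R x / 2")
      case True
      then have "c \<le> R y" using c(2)[of "(x, y)"] 1 by simp
      then have "M * c \<le> M * R y" using M by (intro mult_left_mono) auto
      moreover have "M * c = C + 1" using c by (simp add: M_def)
      moreover have "\<bar>F x y\<bar> \<le> C" using C(2)[of x y] 1 by simp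
      moreover have "R x \<le> 1" using 1 R_nonneg[of y] by simp
      ultimately show ?thesis by linarith
    qed (use y0 in linarith)
  qed (simp_all add: hom R_T algebra_simps)
  then show ?thesis using M that by blast
qed

context
  assumes flat: "(R has_derivative (\<lambda>_. 0)) (at 0)"
begin

text \<open>Scalar multiplication commutes with \<open>T\<close>, so the comparison of \<open>R (s *\<^sub>R x)\<close> with \<open>R x\<close> reduces to
points with \<open>R x = 1\<close>. These are bounded, and \<open>R (s *\<^sub>R x)\<close> is \<open>o(s)\<close> there because the
derivative of \<open>R\<close> at its minimum vanishes. This superlinearity is what
allows constants in front of \<open>R\<close> to be traded for a constant in front of its
Legendre-Fenchel transform.\<close>

lemma R_scaleR_le:
  assumes e: "e > 0"
  obtains s0 where "0 < s0" "s0 \<le> 1" "\<And>s x. \<lbrakk>0 < s; s \<le> s0\<rbrakk> \<Longrightarrow> R (s *\<^sub>R x) \<le> e * s * R x"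
proof -
  obtain B where B: "B > 0" "\<And>x. R x \<le> 1 \<Longrightarrow> norm x \<le> B"
    using sublevel_bounded[of 1] by auto
  have "e / B > 0" using e B by simp
  then obtain d where d: "d > 0" "\<And>h. norm h < d \<Longrightarrow> R h \<le> e / B * norm h"
    using flat unfolding has_derivative_at_alt by (fastforce simp: R_0)
  define s0 where "s0 = min 1 (d / (2 * B))"
  have s0: "0 < s0" "s0 \<le> 1" using d B by (auto simp: s0_def)
  have "R (s *\<^sub>R x) \<le> e * s * R x" if s: "0 < s" "s \<le> s0" for s x
  proof (cases "x = 0")
    case True then show ?thesis by (simp add: R_0)
  next
    case False
    then have r: "R x > 0" by (rule R_pos)
    define y where "y = T (1 / R x) x"
    have "R y = 1" using R_T[of "1 / R x" x] r by (simp add: y_def)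
    then have yB: "norm y \<le> B" using B(2) by simp
    have "s * norm y \<le> d / (2 * B) * B" using s yB s0 d B by (intro mult_mono) (auto simp: s0_def)
    also have "\<dots> < d" using d B by simp
    finally have "R (s *\<^sub>R y) \<le> e / B * (s * norm y)" using d(2)[of "s *\<^sub>R y"] s by simp
    also have "\<dots> \<le> e / B * (s * B)" using e B s yB by (intro mult_left_mono) auto
    also have "\<dots> = e * s" using B by simp
    finally have *: "R (s *\<^sub>R y) \<le> e * s" .
    have "s *\<^sub>R x = T (R x) (s *\<^sub>R y)"
      unfolding y_def T_scaleR[OF r] T_inverse[OF r] ..
    then have "R (s *\<^sub>R x) = R x * R (s *\<^sub>R y)" using R_T[OF r] by metis
    also have "\<dots> \<le> R x * (e * s)" using r * by simp
    finally show ?thesis by (simp add: mult_ac)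
  qed
  then show ?thesis using s0 that by blast
qed

lemma R_linear_growth:
  assumes \<delta>: "\<delta> > 0"
  obtains c where "c > 0" "\<And>x. norm x \<ge> \<delta> \<Longrightarrow> R x \<ge> c * norm x"
proof -
  obtain s0 where s0: "0 < s0" "s0 \<le> 1" "\<And>s x. \<lbrakk>0 < s; s \<le> s0\<rbrakk> \<Longrightarrow> R (s *\<^sub>R x) \<le> s * R x"
    using R_scaleR_le[of 1] by auto
  obtain c where c: "c > 0" "\<And>x. norm x \<ge> s0 * \<delta> \<Longrightarrow> R x \<ge> c"
    using R_bounded_below_outside_ball[of "s0 * \<delta>"] s0 \<delta> by auto
  have "R x \<ge> c / (s0 * \<delta>) * norm x" if x: "norm x \<ge> \<delta>" for x
  proof -
    define s where "s = s0 * \<delta> / norm x"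
    have nx: "norm x > 0" using x \<delta> by linarith
    have s: "0 < s" "s \<le> s0" using s0 \<delta> x nx by (auto simp: s_def field_simps)
    have "norm (s *\<^sub>R x) = s0 * \<delta>" using nx s0 \<delta> by (simp add: s_def)
    then have "c \<le> R (s *\<^sub>R x)" using c(2) by simp
    also have "\<dots> \<le> s * R x" by (rule s0(3)[OF s])
    finally show ?thesis using nx s0 \<delta> by (simp add: s_def field_simps)
  qed
  moreover have "c / (s0 * \<delta>) > 0" using c s0 \<delta> by simp
  ultimately show ?thesis using that by blast
qed

end

end

section \<open>Fourier transforms and convolution powers\<close>

lemma real_vec_add: "real_vec (x + y) = real_vec x + real_vec y"
  and real_vec_diff: "real_vec (x - y) = real_vec x - real_vec y"
  by (simp_all add: real_vec_def vec_eq_iff)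

lemma fourier_eq_sum:
  assumes "finite S" "{x. \<phi> x \<noteq> 0} \<subseteq> S"
  shows "fourier \<phi> \<xi> = (\<Sum>x\<in>S. \<phi> x * exp (\<i> * complex_of_real (real_vec x \<bullet> \<xi>)))"
proof -
  have "fourier \<phi> \<xi> = (\<Sum>\<^sub>\<infinity>x\<in>S. \<phi> x * exp (\<i> * complex_of_real (real_vec x \<bullet> \<xi>)))"
    unfolding fourier_def by (rule infsum_cong_neutral) (use assms in auto)
  then show ?thesis using assms by simp
qed

lemma conv_eq_sum:
  assumes "finite S" "{x. \<phi> x \<noteq> 0} \<subseteq> S"
  shows "conv \<psi> \<phi> x = (\<Sum>y\<in>S. \<psi> (x - y) * \<phi> y)"
proof -
  have "conv \<psi> \<phi> x = (\<Sum>\<^sub>\<infinity>y\<in>S. \<psi> (x - y) * \<phi> y)"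
    unfolding conv_def by (rule infsum_cong_neutral) (use assms in auto)
  then show ?thesis using assms by simp
qed

lemma conv_support_subset:
  assumes "finite {x. \<phi> x \<noteq> 0}"
  shows "{x. conv \<psi> \<phi> x \<noteq> 0} \<subseteq> (\<lambda>(a, b). a + b) ` ({x. \<psi> x \<noteq> 0} \<times> {x. \<phi> x \<noteq> 0})"
proof
  fix x assume "x \<in> {x. conv \<psi> \<phi> x \<noteq> 0}"
  then have "(\<Sum>y\<in>{x. \<phi> x \<noteq> 0}. \<psi> (x - y) * \<phi> y) \<noteq> 0"
    using conv_eq_sum[OF assms order_refl] by simp
  then obtain y where "\<psi> (x - y) * \<phi> y \<noteq> 0" by (meson sum.not_neutral_contains_not_neutral)
  then show "x \<in> (\<lambda>(a, b). a + b) ` ({x. \<psi> x \<noteq> 0} \<times> {x. \<phi> x \<noteq> 0})"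
    by (intro image_eqI[of _ _ "(x - y, y)"]) auto
qed

lemma finite_support_conv:
  assumes "finite {x. \<psi> x \<noteq> 0}" "finite {x. \<phi> x \<noteq> 0}"
  shows "finite {x. conv \<psi> \<phi> x \<noteq> 0}"
  using conv_support_subset[OF assms(2)] assms by (meson finite_SigmaI finite_imageI finite_subset)

text \<open>Both sides are finite sums once a finite set \<open>Z\<close> containing all sums of points of the two supports
replaces the lattice.\<close>

lemma fourier_conv:
  assumes fin: "finite {x. \<psi> x \<noteq> 0}" "finite {x. \<phi> x \<noteq> 0}"
  shows "fourier (conv \<psi> \<phi>) \<xi> = fourier \<psi> \<xi> * fourier \<phi> \<xi>"
proof -
  define e where "e x = exp (\<i> * complex_of_real (real_vec x \<bullet> \<xi>))" for x
  have e_add: "e (x + y) = e x * e y" for x y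
    by (simp add: e_def real_vec_add inner_add_left exp_add[symmetric] algebra_simps)
  define S where "S = {x. \<phi> x \<noteq> 0}"
  define Z where "Z = (\<lambda>(a, b). a + b) ` ({x. \<psi> x \<noteq> 0} \<times> S)"
  have finZ: "finite Z" using fin by (auto simp: Z_def S_def)
  have shift: "fourier \<psi> \<xi> = (\<Sum>x\<in>Z. \<psi> (x - y) * e (x - y))" if "y \<in> S" for y
  proof -
    have "{x. \<psi> x \<noteq> 0} \<subseteq> (\<lambda>x. x - y) ` Z"
    proof
      fix a assume "a \<in> {x. \<psi> x \<noteq> 0}"
      then have "a + y \<in> Z" using that by (auto simp: Z_def intro!: image_eqI[of _ _ "(a, y)"])
      then show "a \<in> (\<lambda>x. x - y) ` Z" by (intro image_eqI[of _ _ "a + y"]) auto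
    qed
    from fourier_eq_sum[OF _ this] finZ
    have "fourier \<psi> \<xi> = (\<Sum>x\<in>(\<lambda>x. x - y) ` Z. \<psi> x * e x)" by (simp add: e_def)
    also have "\<dots> = (\<Sum>x\<in>Z. \<psi> (x - y) * e (x - y))"
      by (subst sum.reindex) (auto simp: inj_on_def)
    finally show ?thesis .
  qed
  have "fourier (conv \<psi> \<phi>) \<xi> = (\<Sum>x\<in>Z. conv \<psi> \<phi> x * e x)"
    unfolding e_def by (rule fourier_eq_sum[OF finZ]) (use conv_support_subset[OF fin(2)] in \<open>simp add: Z_def S_def\<close>)
  also have "\<dots> = (\<Sum>x\<in>Z. \<Sum>y\<in>S. (\<psi> (x - y) * e (x - y)) * (\<phi> y * e y))"
  proof (rule sum.cong[OF refl])
    fix x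
    have ee: "e x = e (x - y) * e y" for y using e_add[of "x - y" y] by simp
    show "conv \<psi> \<phi> x * e x = (\<Sum>y\<in>S. (\<psi> (x - y) * e (x - y)) * (\<phi> y * e y))"
      unfolding conv_eq_sum[OF fin(2) order_refl] S_def sum_distrib_right
    proof (rule sum.cong[OF refl])
      fix y
      show "\<psi> (x - y) * \<phi> y * e x = \<psi> (x - y) * e (x - y) * (\<phi> y * e y)"
        unfolding ee[of y] by simp
    qed
  qed
  also have "\<dots> = (\<Sum>y\<in>S. (\<Sum>x\<in>Z. \<psi> (x - y) * e (x - y)) * (\<phi> y * e y))"
    by (subst sum.swap) (simp add: sum_distrib_right)
  also have "\<dots> = fourier \<psi> \<xi> * (\<Sum>y\<in>S. \<phi> y * e y)"
    by (simp add: shift[symmetric] sum_distrib_left)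
  also have "(\<Sum>y\<in>S. \<phi> y * e y) = fourier \<phi> \<xi>"
    unfolding e_def S_def using fin(2) by (intro fourier_eq_sum[symmetric]) auto
  finally show ?thesis .
qed

lemma conv_power_finite_support_and_fourier:
  assumes fin: "finite {x. \<phi> x \<noteq> 0}"
  shows "finite {x. conv_power \<phi> (Suc n) x \<noteq> 0} \<and> fourier (conv_power \<phi> (Suc n)) \<xi> = fourier \<phi> \<xi> ^ Suc n"
proof (induction n)
  case 0 then show ?case using fin by simp
next
  case (Suc n)
  then have "finite {x. conv (conv_power \<phi> (Suc n)) \<phi> x \<noteq> 0}"
    using fin finite_support_conv by blast
  then show ?case using Suc fin fourier_conv[of "conv_power \<phi> (Suc n)" \<phi>]
    by (simp del: power_Suc add: power_Suc2)
qed

text \<open>Multiplication by \<open>exp (x \<bullet> \<nu>)\<close> shifts the Fourier transform to the complex frequency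
\<open>\<xi> - \<i> \<nu>\<close>. It commutes with convolution, so no contour has to be moved in the inversion formula.\<close>

definition tilt :: "real ^ 'd \<Rightarrow> (int ^ 'd \<Rightarrow> complex) \<Rightarrow> int ^ 'd::finite \<Rightarrow> complex" where
  "tilt \<nu> \<phi> x = \<phi> x * complex_of_real (exp (real_vec x \<bullet> \<nu>))"

lemma tilt_eq_0_iff: "tilt \<nu> \<phi> x = 0 \<longleftrightarrow> \<phi> x = 0"
  by (simp add: tilt_def)

lemma conv_tilt: "conv (tilt \<nu> \<psi>) (tilt \<nu> \<phi>) = tilt \<nu> (conv \<psi> \<phi>)"
proof
  fix x
  have "tilt \<nu> \<psi> (x - y) * tilt \<nu> \<phi> y = \<psi> (x - y) * \<phi> y * complex_of_real (exp (real_vec x \<bullet> \<nu>))" for y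
    by (simp add: tilt_def real_vec_diff inner_diff_left exp_diff of_real_divide)
  then show "conv (tilt \<nu> \<psi>) (tilt \<nu> \<phi>) x = tilt \<nu> (conv \<psi> \<phi>) x"
    unfolding conv_def tilt_def[of _ "conv \<psi> \<phi>"] by (simp add: infsum_cmult_left')
qed

lemma conv_power_tilt: "conv_power (tilt \<nu> \<phi>) (Suc n) = tilt \<nu> (conv_power \<phi> (Suc n))"
  by (induction n) (simp_all add: conv_tilt)

lemma
  fixes f :: "'a::euclidean_space \<Rightarrow> real \<Rightarrow> complex"
  assumes f: "\<And>b. b \<in> Basis \<Longrightarrow> integrable lborel (f b)"
  shows integrable_lborel_prod: "integrable lborel (\<lambda>x. \<Prod>b\<in>Basis. f b (x \<bullet> b))"
    and integral_lborel_prod: "(\<integral>x. (\<Prod>b\<in>Basis. f b (x \<bullet> b)) \<partial>lborel) = (\<Prod>b\<in>Basis. \<integral>x. f b x \<partial>lborel)"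
proof -
  interpret product_sigma_finite "\<lambda>_::'a. lborel :: real measure" by standard
  have m[measurable]: "f b \<in> borel_measurable borel" if "b \<in> Basis" for b
    using borel_measurable_integrable[OF f[OF that]] by simp
  have comp: "(\<Sum>b\<in>Basis. x b *\<^sub>R b) \<bullet> c = x c" if "c \<in> Basis" for x and c :: 'a
    using that by (simp add: inner_sum_left_Basis)
  have meas: "(\<lambda>x::'a. \<Prod>b\<in>Basis. f b (x \<bullet> b)) \<in> borel_measurable borel" by measurable
  have i: "integrable (Pi\<^sub>M Basis (\<lambda>_. lborel)) (\<lambda>x. \<Prod>b\<in>Basis. f b (x b))"
    and e: "(\<integral>x. (\<Prod>b\<in>Basis. f b (x b)) \<partial>Pi\<^sub>M Basis (\<lambda>_. lborel)) = (\<Prod>b\<in>Basis. \<integral>x. f b x \<partial>lborel)"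
    using f by (auto intro: product_integrable_prod product_integral_prod)
  show "integrable lborel (\<lambda>x. \<Prod>b\<in>Basis. f b (x \<bullet> b))"
    by (subst lborel_eq, subst integrable_distr_eq) (use meas i in \<open>simp_all add: comp\<close>)
  show "(\<integral>x. (\<Prod>b\<in>Basis. f b (x \<bullet> b)) \<partial>lborel) = (\<Prod>b\<in>Basis. \<integral>x. f b x \<partial>lborel)"
    by (subst lborel_eq, subst integral_distr) (use meas e in \<open>simp_all add: comp\<close>)
qed

abbreviation period_box :: "(real ^ 'd::finite) set" where
  "period_box \<equiv> {\<xi>. \<forall>i. - pi \<le> \<xi> $ i \<and> \<xi> $ i \<le> pi}"

lemma character_integral_interval:
  fixes k :: int
  shows "has_bochner_integral lborel (\<lambda>t. indicator {- pi..pi} t *\<^sub>R exp (\<i> * complex_of_real (of_int k * t)))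
     (if k = 0 then 2 * pi else 0)"
proof (cases "k = 0")
  case True
  have "has_bochner_integral lborel (\<lambda>t::real. indicator {- pi..pi} t *\<^sub>R (1::complex)) (complex_of_real pi - complex_of_real (- pi))"
    by (rule has_bochner_integral_FTC_Icc) (auto intro!: derivative_eq_intros continuous_intros)
  then show ?thesis using True by simp
next
  case False
  define G where "G t = exp (\<i> * complex_of_real (of_int k * t)) / (\<i> * of_int k)" for t
  have "has_bochner_integral lborel (\<lambda>t. indicator {- pi..pi} t *\<^sub>R exp (\<i> * complex_of_real (of_int k * t))) (G pi - G (- pi))"
  proof (rule has_bochner_integral_FTC_Icc)
    fix x :: real
    have "((\<lambda>z. exp (\<i> * (of_int k * z)) / (\<i> * of_int k)) has_field_derivative exp (\<i> * (of_int k * complex_of_real x))) (at (complex_of_real x))"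
      using False by (auto intro!: derivative_eq_intros simp: field_simps)
    from has_vector_derivative_real_field[OF this]
    show "(G has_vector_derivative exp (\<i> * complex_of_real (of_int k * x))) (at x within {- pi..pi})"
      by (simp add: G_def[abs_def] has_vector_derivative_at_within)
  qed (auto intro!: continuous_intros)
  moreover have "G pi = G (- pi)"
  proof -
    have "exp (2 * of_int k * of_real pi * \<i>) = 1"
      using exp_integer_2pi[of "of_int k"] by simp
    moreover have "\<i> * complex_of_real (of_int k * pi) = \<i> * complex_of_real (of_int k * (- pi)) + 2 * of_int k * of_real pi * \<i>"
      by (simp add: algebra_simps)
    ultimately have "exp (\<i> * complex_of_real (of_int k * pi)) = exp (\<i> * complex_of_real (of_int k * (- pi)))"
      by (metis exp_add mult.right_neutral)
    then show ?thesis unfolding G_def by (simp only:)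
  qed
  ultimately show ?thesis using False by simp
qed

lemma character_integral_period_box:
  fixes m :: "int ^ 'd::finite"
  shows "has_bochner_integral lborel (\<lambda>\<xi>. indicator period_box \<xi> *\<^sub>R exp (\<i> * complex_of_real (real_vec m \<bullet> \<xi>)))
     (if m = 0 then (2 * pi) ^ CARD('d) else 0)"
proof -
  (* The product formula is indexed by basis vectors; k b is the coordinate of m that belongs to b. *)
  define k where "k b = (\<Sum>i\<in>UNIV. if b = axis i 1 then m $ i else 0)" for b :: "real ^ 'd"
  have k: "k (axis i 1) = m $ i" for i
    by (simp add: k_def axis_eq_axis)
  define f where "f b t = indicator {- pi..pi} t *\<^sub>R exp (\<i> * complex_of_real (of_int (k b) * t))" for b t
  have hf: "has_bochner_integral lborel (f b) (if k b = 0 then 2 * pi else 0)" for b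
    unfolding f_def[abs_def] by (rule character_integral_interval)
  have prodB: "(\<Prod>b\<in>(Basis :: (real ^ 'd) set). g b) = (\<Prod>i\<in>UNIV. g (axis i 1))" for g :: "_ \<Rightarrow> complex"
    by (simp add: Basis_vec_def prod.reindex[of "\<lambda>i. axis i 1"] inj_on_def axis_eq_axis UNION_singleton_eq_range)
  have eq: "(\<Prod>b\<in>Basis. f b (\<xi> \<bullet> b)) = indicator period_box \<xi> *\<^sub>R exp (\<i> * complex_of_real (real_vec m \<bullet> \<xi>))" for \<xi> :: "real ^ 'd"
  proof -
    have "(\<Prod>b\<in>Basis. f b (\<xi> \<bullet> b)) = (\<Prod>i\<in>UNIV. indicator {- pi..pi} (\<xi> $ i) *\<^sub>R exp (\<i> * complex_of_real (of_int (m $ i) * \<xi> $ i)))"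
      unfolding prodB by (simp add: f_def k inner_axis)
    also have "\<dots> = (\<Prod>i\<in>UNIV. complex_of_real (indicator {- pi..pi} (\<xi> $ i))) * (\<Prod>i\<in>UNIV. exp (\<i> * complex_of_real (of_int (m $ i) * \<xi> $ i)))"
      by (simp add: scaleR_conv_of_real prod.distrib)
    also have "(\<Prod>i\<in>UNIV. exp (\<i> * complex_of_real (of_int (m $ i) * \<xi> $ i))) = exp (\<i> * complex_of_real (real_vec m \<bullet> \<xi>))"
      by (simp add: exp_sum[symmetric] inner_vec_def real_vec_def sum_distrib_left)
    also have "(\<Prod>i\<in>UNIV. complex_of_real (indicator {- pi..pi} (\<xi> $ i))) = complex_of_real (indicator period_box \<xi>)"
    proof (cases "\<xi> \<in> period_box")
      case True then show ?thesis by simp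
    next
      case False
      then obtain i where "indicator {- pi..pi} (\<xi> $ i) = (0::real)" by (auto simp: indicator_def)
      then show ?thesis using False by (auto intro!: prod_zero bexI[of _ i])
    qed
    finally show ?thesis by (simp add: scaleR_conv_of_real)
  qed
  have int: "integrable lborel (f b)" for b using hf has_bochner_integral_iff by blast
  have val: "(\<integral>x. f b x \<partial>lborel) = (if k b = 0 then 2 * pi else 0)" for b
    using hf[of b] by (simp add: has_bochner_integral_iff)
  have "(\<Prod>b\<in>Basis. \<integral>x. f b x \<partial>lborel) = (if m = 0 then (2 * pi) ^ CARD('d) else 0)"
  proof (cases "m = 0")
    case True
    then show ?thesis unfolding prodB val by (simp add: k)
  next
    case False
    then obtain i where "m $ i \<noteq> 0" by (auto simp: vec_eq_iff)
    then show ?thesis unfolding prodB val using False by (auto simp: k intro!: prod_zero bexI[of _ i])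
  qed
  then show ?thesis
    using integrable_lborel_prod[of f] integral_lborel_prod[of f] int by (simp add: has_bochner_integral_iff eq)
qed

text \<open>Fourier inversion by orthogonality of characters. It is applied to the tilted powers.\<close>

lemma norm_le_integral_fourier:
  fixes \<psi> :: "int ^ 'd::finite \<Rightarrow> complex"
  assumes fin: "finite {x. \<psi> x \<noteq> 0}"
  shows "ennreal ((2 * pi) ^ CARD('d) * cmod (\<psi> x))
     \<le> (\<integral>\<^sup>+\<xi>. indicator period_box \<xi> * ennreal (cmod (fourier \<psi> \<xi>)) \<partial>lborel)"
proof -
  let ?S = "insert x {y. \<psi> y \<noteq> 0}"
  define h where "h \<xi> = indicator period_box \<xi> *\<^sub>R (fourier \<psi> \<xi> * exp (- (\<i> * complex_of_real (real_vec x \<bullet> \<xi>))))" for \<xi>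
  have h: "h \<xi> = (\<Sum>y\<in>?S. \<psi> y * (indicator period_box \<xi> *\<^sub>R exp (\<i> * complex_of_real (real_vec (y - x) \<bullet> \<xi>))))" for \<xi>
  proof -
    have "fourier \<psi> \<xi> = (\<Sum>y\<in>?S. \<psi> y * exp (\<i> * complex_of_real (real_vec y \<bullet> \<xi>)))"
      using fin by (intro fourier_eq_sum) auto
    then show ?thesis unfolding h_def
      by (simp only: sum_distrib_right scaleR_sum_right)
        (intro sum.cong refl, simp add: real_vec_diff inner_diff_left exp_diff exp_minus field_simps)
  qed
  have "has_bochner_integral lborel h (\<Sum>y\<in>?S. \<psi> y * (if y - x = 0 then (2 * pi) ^ CARD('d) else 0))"
    unfolding h by (intro has_bochner_integral_sum has_bochner_integral_mult_right character_integral_period_box)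
  also have "(\<Sum>y\<in>?S. \<psi> y * (if y - x = 0 then (2 * pi) ^ CARD('d) else 0))
     = (\<Sum>y\<in>?S. if y = x then \<psi> x * (2 * pi) ^ CARD('d) else 0)"
    by (intro sum.cong) auto
  also have "\<dots> = \<psi> x * (2 * pi) ^ CARD('d)" using fin by (simp del: sum.insert)
  finally have H: "integrable lborel h" "integral\<^sup>L lborel h = \<psi> x * (2 * pi) ^ CARD('d)"
    by (auto simp: has_bochner_integral_iff)
  have "ennreal ((2 * pi) ^ CARD('d) * cmod (\<psi> x)) = ennreal (cmod (integral\<^sup>L lborel h))"
    unfolding H(2) by (simp add: norm_mult norm_power mult.commute)
  also have "\<dots> \<le> (\<integral>\<^sup>+\<xi>. ennreal (cmod (h \<xi>)) \<partial>lborel)"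
    by (rule integral_norm_bound_ennreal[OF H(1)])
  also have "\<dots> = (\<integral>\<^sup>+\<xi>. indicator period_box \<xi> * ennreal (cmod (fourier \<psi> \<xi>)) \<partial>lborel)"
    by (intro nn_integral_cong) (simp add: h_def norm_mult indicator_def)
  finally show ?thesis .
qed

text \<open>The restriction of the Fourier transform to a complex line, as an entire function of the line
parameter \<open>s\<close>. Nonnegative integers \<open>s = k\<close> give the real frequencies \<open>\<xi> + k \<nu>\<close>, and \<open>s = - \<i>\<close> gives
\<open>\<xi> - \<i> \<nu>\<close>.\<close>

lemma fourier_tilt_line:
  fixes \<phi> :: "int ^ 'd::finite \<Rightarrow> complex"
  assumes S: "finite S" "{x. \<phi> x \<noteq> 0} \<subseteq> S"
  shows "fourier (tilt (- Im s *\<^sub>R \<nu>) \<phi>) (\<xi> + Re s *\<^sub>R \<nu>)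
    = (\<Sum>x\<in>S. \<phi> x * exp (\<i> * (complex_of_real (real_vec x \<bullet> \<xi>) + s * complex_of_real (real_vec x \<bullet> \<nu>))))"
proof -
  have "fourier (tilt (- Im s *\<^sub>R \<nu>) \<phi>) (\<xi> + Re s *\<^sub>R \<nu>)
     = (\<Sum>x\<in>S. tilt (- Im s *\<^sub>R \<nu>) \<phi> x * exp (\<i> * complex_of_real (real_vec x \<bullet> (\<xi> + Re s *\<^sub>R \<nu>))))"
    using S by (intro fourier_eq_sum) (auto simp: tilt_eq_0_iff)
  also have "\<dots> = (\<Sum>x\<in>S. \<phi> x * exp (\<i> * (complex_of_real (real_vec x \<bullet> \<xi>) + s * complex_of_real (real_vec x \<bullet> \<nu>))))"
  proof (rule sum.cong[OF refl])
    fix x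
    let ?a = "real_vec x \<bullet> \<xi>" and ?b = "real_vec x \<bullet> \<nu>"
    have "complex_of_real (exp (real_vec x \<bullet> (- Im s *\<^sub>R \<nu>))) * exp (\<i> * complex_of_real (real_vec x \<bullet> (\<xi> + Re s *\<^sub>R \<nu>)))
      = exp (complex_of_real (- Im s * ?b) + \<i> * complex_of_real (?a + Re s * ?b))"
      unfolding exp_add exp_of_real by (simp add: inner_add_right)
    also have "complex_of_real (- Im s * ?b) + \<i> * complex_of_real (?a + Re s * ?b)
      = \<i> * (complex_of_real ?a + s * complex_of_real ?b)"
      by (simp add: complex_eq_iff)
    finally show "tilt (- Im s *\<^sub>R \<nu>) \<phi> x * exp (\<i> * complex_of_real (real_vec x \<bullet> (\<xi> + Re s *\<^sub>R \<nu>)))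
       = \<phi> x * exp (\<i> * (complex_of_real ?a + s * complex_of_real ?b))"
      by (simp add: tilt_def mult.assoc)
  qed
  finally show ?thesis .
qed

lemma tilt_zero: "tilt 0 \<phi> = \<phi>"
  by (simp add: tilt_def fun_eq_iff)

lemma continuous_fourier_tilt:
  fixes \<phi> :: "int ^ 'd::finite \<Rightarrow> complex"
  assumes fin: "finite {x. \<phi> x \<noteq> 0}"
  shows "continuous_on UNIV (\<lambda>p. fourier (tilt (snd p) \<phi>) (fst p))"
proof -
  have "fourier (tilt \<nu> \<phi>) \<xi> = (\<Sum>x\<in>{x. \<phi> x \<noteq> 0}. tilt \<nu> \<phi> x * exp (\<i> * complex_of_real (real_vec x \<bullet> \<xi>)))" for \<nu> \<xi>
    using fin by (intro fourier_eq_sum) (auto simp: tilt_eq_0_iff)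
  then show ?thesis unfolding tilt_def by (auto intro!: continuous_intros)
qed

lemma fourier_periodic:
  "fourier \<phi> (\<xi> + (2 * pi) *\<^sub>R real_vec m) = fourier \<phi> \<xi>"
  unfolding fourier_def
proof (rule infsum_cong)
  fix x :: "int ^ 'a"
  have "real_vec x \<bullet> real_vec m = of_int (\<Sum>i\<in>UNIV. x $ i * m $ i)"
    by (simp add: real_vec_def inner_vec_def)
  then obtain k :: int where k: "real_vec x \<bullet> real_vec m = of_int k" by blast
  have "exp (2 * of_int k * of_real pi * \<i>) = 1"
    using exp_integer_2pi[of "of_int k"] by simp
  moreover have "\<i> * complex_of_real (real_vec x \<bullet> (\<xi> + (2 * pi) *\<^sub>R real_vec m))
      = \<i> * complex_of_real (real_vec x \<bullet> \<xi>) + 2 * of_int k * of_real pi * \<i>"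
    by (simp add: inner_add_right k algebra_simps)
  ultimately show "\<phi> x * exp (\<i> * complex_of_real (real_vec x \<bullet> (\<xi> + (2 * pi) *\<^sub>R real_vec m)))
     = \<phi> x * exp (\<i> * complex_of_real (real_vec x \<bullet> \<xi>))"
    by (metis exp_add mult.right_neutral)
qed

lemma translate_into_torus:
  obtains m where "\<xi> + (2 * pi) *\<^sub>R real_vec m \<in> torus"
proof
  (* The floor is chosen so that the right endpoint pi is kept and the left endpoint is excluded. *)
  let ?m = "\<chi> i. \<lfloor>(pi - \<xi> $ i) / (2 * pi)\<rfloor>"
  have "- pi < \<xi> $ i + 2 * pi * of_int (?m $ i) \<and> \<xi> $ i + 2 * pi * of_int (?m $ i) \<le> pi" for i
  proof -
    have "- pi < t + 2 * pi * of_int k \<and> t + 2 * pi * of_int k \<le> pi"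
      if "of_int k \<le> (pi - t) / (2 * pi)" "(pi - t) / (2 * pi) < of_int k + 1" for t :: real and k :: int
      using that pi_gt_zero by (simp add: field_simps)
    from this[of "?m $ i" "\<xi> $ i"] show ?thesis by (simp add: real_of_int_floor_add_one_gt)
  qed
  then show "\<xi> + (2 * pi) *\<^sub>R real_vec ?m \<in> torus" by (simp add: torus_def real_vec_def)
qed

lemma torus_subset_period_box: "torus \<subseteq> period_box"
  by (auto simp: torus_def intro: less_imp_le)

lemma period_box_eq_cbox: "period_box = cbox (\<chi> i. - pi) (\<chi> i. pi)"
  by (auto simp: mem_box_cart)

lemma continuous_on_fourier:
  assumes "finite {x. \<phi> x \<noteq> 0}"
  shows "continuous_on S (fourier \<phi>)"
proof -
  have "continuous_on UNIV (\<lambda>\<xi> :: real ^ 'a. (\<xi>, 0 :: real ^ 'a))" by (intro continuous_intros)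
  from continuous_on_compose2[OF continuous_fourier_tilt[OF assms] this]
  have "continuous_on UNIV (fourier \<phi>)" by (simp add: tilt_zero)
  then show ?thesis by (rule continuous_on_subset) simp
qed

lemma norm_fourier_le_one:
  assumes fin: "finite {x. \<phi> x \<noteq> 0}" and sup: "(SUP \<xi>\<in>torus. cmod (fourier \<phi> \<xi>)) = 1"
  shows "cmod (fourier \<phi> \<xi>) \<le> 1"
proof -
  obtain m where m: "\<xi> + (2 * pi) *\<^sub>R real_vec m \<in> torus" by (rule translate_into_torus)
  have "compact ((\<lambda>\<xi>. cmod (fourier \<phi> \<xi>)) ` period_box)"
    unfolding period_box_eq_cbox
    by (intro compact_continuous_image continuous_intros continuous_on_fourier fin compact_cbox)
  then have "bdd_above ((\<lambda>\<xi>. cmod (fourier \<phi> \<xi>)) ` period_box)"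
    by (intro bounded_imp_bdd_above compact_imp_bounded)
  then have "bdd_above ((\<lambda>\<xi>. cmod (fourier \<phi> \<xi>)) ` torus)"
    by (rule bdd_above_mono) (intro image_mono torus_subset_period_box)
  from cSUP_upper[OF m this] show ?thesis using sup by (simp add: fourier_periodic)
qed

lemma Omega_nonempty:
  assumes fin: "finite {x. \<phi> x \<noteq> 0}" and sup: "(SUP \<xi>\<in>torus. cmod (fourier \<phi> \<xi>)) = 1"
  obtains \<xi> where "\<xi> \<in> Omega \<phi>"
proof -
  have ne: "torus \<noteq> ({} :: (real ^ 'a) set)" by (rule translate_into_torus[of 0]) auto
  have "compact (period_box :: (real ^ 'a) set)" unfolding period_box_eq_cbox by (rule compact_cbox)
  moreover have "(period_box :: (real ^ 'a) set) \<noteq> {}" using ne torus_subset_period_box by blast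
  moreover have "continuous_on period_box (\<lambda>\<xi>. cmod (fourier \<phi> \<xi>))"
    by (intro continuous_intros continuous_on_fourier fin)
  ultimately obtain \<xi> where \<xi>: "\<xi> \<in> period_box" "\<And>\<eta>. \<eta> \<in> period_box \<Longrightarrow> cmod (fourier \<phi> \<eta>) \<le> cmod (fourier \<phi> \<xi>)"
    using continuous_attains_sup[of period_box "\<lambda>\<xi>. cmod (fourier \<phi> \<xi>)"] by blast
  have "(SUP \<xi>\<in>torus. cmod (fourier \<phi> \<xi>)) \<le> cmod (fourier \<phi> \<xi>)"
    using \<xi>(2) torus_subset_period_box ne by (intro cSUP_least) auto
  then have "cmod (fourier \<phi> \<xi>) = 1"
    using sup norm_fourier_le_one[OF assms, of \<xi>] by simp
  moreover obtain m where "\<xi> + (2 * pi) *\<^sub>R real_vec m \<in> torus" by (rule translate_into_torus)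
  ultimately have "\<xi> + (2 * pi) *\<^sub>R real_vec m \<in> Omega \<phi>" by (simp add: Omega_def fourier_periodic)
  then show ?thesis by (rule that)
qed

text \<open>By periodicity the hypothesis on points of the half-open torus applies to every real frequency at
which the Fourier transform has modulus one, in particular on the boundary of the closed box, where
compactness arguments are available.\<close>

lemma positive_homogeneous_type_translate:
  "positive_homogeneous_type \<phi> (\<xi> + (2 * pi) *\<^sub>R real_vec m) \<alpha> P \<longleftrightarrow> positive_homogeneous_type \<phi> \<xi> \<alpha> P"
proof -
  have "fourier \<phi> (\<eta> + (\<xi> + (2 * pi) *\<^sub>R real_vec m)) = fourier \<phi> (\<eta> + \<xi>)" for \<eta>
    using fourier_periodic[of \<phi> "\<eta> + \<xi>" m] by (simp add: add.assoc)
  then have "Gamma_log \<phi> (\<xi> + (2 * pi) *\<^sub>R real_vec m) = Gamma_log \<phi> \<xi>"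
    by (simp add: Gamma_log_def fun_eq_iff fourier_periodic)
  then show ?thesis by (simp add: positive_homogeneous_type_def)
qed

text \<open>The Fourier transform is uniformly close to its tilted version when \<open>\<nu>\<close> is small; this preserves a gap below 1.\<close>

lemma norm_fourier_tilt_le:
  assumes fin: "finite {x. \<phi> x \<noteq> 0}"
  shows "cmod (fourier (tilt \<nu> \<phi>) \<xi>) \<le> cmod (fourier \<phi> \<xi>)
     + (\<Sum>x\<in>{x. \<phi> x \<noteq> 0}. cmod (\<phi> x) * \<bar>exp (real_vec x \<bullet> \<nu>) - 1\<bar>)"
proof -
  let ?S = "{x. \<phi> x \<noteq> 0}" and ?e = "\<lambda>x. exp (\<i> * complex_of_real (real_vec x \<bullet> \<xi>))"
  have "fourier (tilt \<nu> \<phi>) \<xi> = (\<Sum>x\<in>?S. tilt \<nu> \<phi> x * ?e x)"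
    using fin by (intro fourier_eq_sum) (auto simp: tilt_eq_0_iff)
  also have "\<dots> = (\<Sum>x\<in>?S. \<phi> x * ?e x) + (\<Sum>x\<in>?S. \<phi> x * complex_of_real (exp (real_vec x \<bullet> \<nu>) - 1) * ?e x)"
    by (simp add: sum.distrib[symmetric] tilt_def algebra_simps)
  also have "(\<Sum>x\<in>?S. \<phi> x * ?e x) = fourier \<phi> \<xi>"
    using fin by (intro fourier_eq_sum[symmetric]) auto
  finally have eq: "fourier (tilt \<nu> \<phi>) \<xi> = fourier \<phi> \<xi> + (\<Sum>x\<in>?S. \<phi> x * complex_of_real (exp (real_vec x \<bullet> \<nu>) - 1) * ?e x)" .
  have bound: "cmod (\<Sum>x\<in>?S. \<phi> x * complex_of_real (exp (real_vec x \<bullet> \<nu>) - 1) * ?e x)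
      \<le> (\<Sum>x\<in>?S. cmod (\<phi> x) * \<bar>exp (real_vec x \<bullet> \<nu>) - 1\<bar>)"
    by (rule sum_norm_le) (simp only: norm_mult norm_of_real norm_exp_i_times mult_1_right order_refl)
  show ?thesis
    unfolding eq by (rule order_trans[OF norm_triangle_ineq add_left_mono[OF bound]])
qed

text \<open>Finite support makes the growth in \<open>\<nu>\<close> at most exponential; this serves for large \<open>\<nu>\<close>.\<close>

lemma norm_fourier_tilt_le_exp:
  fixes \<phi> :: "int ^ 'd::finite \<Rightarrow> complex"
  assumes fin: "finite {x. \<phi> x \<noteq> 0}"
  obtains A b where "A \<ge> 0" "b \<ge> 0" "\<And>\<nu> \<xi>. cmod (fourier (tilt \<nu> \<phi>) \<xi>) \<le> exp (A + b * norm \<nu>)"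
proof -
  let ?S = "{x. \<phi> x \<noteq> 0}"
  define a where "a = 1 + (\<Sum>x\<in>?S. cmod (\<phi> x))"
  define b where "b = (\<Sum>x\<in>?S. norm (real_vec x))"
  have a: "a \<ge> 1" by (simp add: a_def sum_nonneg)
  have b: "b \<ge> 0" by (simp add: b_def sum_nonneg)
  have "cmod (fourier (tilt \<nu> \<phi>) \<xi>) \<le> exp (ln a + b * norm \<nu>)" for \<nu> \<xi>
  proof -
    have "fourier (tilt \<nu> \<phi>) \<xi> = (\<Sum>x\<in>?S. tilt \<nu> \<phi> x * exp (\<i> * complex_of_real (real_vec x \<bullet> \<xi>)))"
      using fin by (intro fourier_eq_sum) (auto simp: tilt_eq_0_iff)
    also have "cmod \<dots> \<le> (\<Sum>x\<in>?S. cmod (\<phi> x) * exp (b * norm \<nu>))"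
    proof (rule sum_norm_le)
      fix x assume x: "x \<in> ?S"
      have "real_vec x \<bullet> \<nu> \<le> norm (real_vec x) * norm \<nu>" by (rule norm_cauchy_schwarz)
      also have "\<dots> \<le> b * norm \<nu>"
        unfolding b_def using fin x by (intro mult_right_mono member_le_sum) auto
      finally have "exp (real_vec x \<bullet> \<nu>) \<le> exp (b * norm \<nu>)" by simp
      then show "cmod (tilt \<nu> \<phi> x * exp (\<i> * complex_of_real (real_vec x \<bullet> \<xi>))) \<le> cmod (\<phi> x) * exp (b * norm \<nu>)"
        unfolding tilt_def norm_mult norm_exp_i_times norm_of_real by (simp add: mult_left_mono)
    qed
    also have "\<dots> \<le> a * exp (b * norm \<nu>)"
      unfolding sum_distrib_right[symmetric] by (intro mult_right_mono) (auto simp: a_def)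
    also have "\<dots> = exp (ln a + b * norm \<nu>)" using a by (simp add: exp_add)
    finally show ?thesis .
  qed
  then show ?thesis using that[of "ln a" b] a b by simp
qed

section \<open>Estimates at complex frequencies\<close>

text \<open>The complex-valued symbol has weight one as well; its real part is the function \<open>R\<close> from before.\<close>

locale complex_homogeneous_flow = homogeneous_flow "\<lambda>\<xi>. Re (P \<xi>)" T
  for P :: "real ^ 'd::finite \<Rightarrow> complex" and T +
  assumes continuous_P: "continuous_on UNIV P"
    and P_T: "t > 0 \<Longrightarrow> P (T t x) = complex_of_real t * P x"
begin

abbreviation R where "R \<xi> \<equiv> Re (P \<xi>)"

lemma P_0: "P 0 = 0"
  using P_T[of 2 0] T_0[of 2] by simp

text \<open>The heart of the proof. Near a maximum \<open>\<xi>0\<close>, the logarithm of the Fourier transform is analytic on the complex line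
through \<open>\<xi>\<close> in the direction \<open>\<nu>\<close>, on a disc whose radius is inversely proportional to the norm of \<open>\<nu>\<close>.
Interpolation gives its value at \<open>s = - \<i>\<close> from the real points \<open>\<xi> + k \<nu>\<close>, up to an error of
order \<open>norm \<nu> ^ Suc N\<close>, which is small compared with \<open>R \<nu>\<close>. The remainder \<open>\<Upsilon>\<close> is controlled at the real points
because it is \<open>o(R)\<close> there. The drift is linear and
is interpolated exactly, and the interpolated symbol \<open>Q \<xi> \<nu>\<close> stands for \<open>P (\<xi> - \<i> \<nu>)\<close>: it is
continuous, has weight one and equals \<open>P \<xi>\<close> for \<open>\<nu> = 0\<close>, which is enough to bound its real part
from below by \<open>R \<xi> / 2 - M * R \<nu>\<close>. The constant \<open>M\<close> depends on the symbol only and not on \<open>\<xi>0\<close>.\<close>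

lemma local_estimate:
  obtains M where "M > 0"
    and "\<And>\<phi> \<xi>0 \<alpha> U \<Upsilon>. \<lbrakk>finite {x. \<phi> x \<noteq> 0}; cmod (fourier \<phi> \<xi>0) = 1; open U; 0 \<in> U;
       \<And>\<xi>. \<xi> \<in> U \<Longrightarrow> Gamma_log \<phi> \<xi>0 \<xi> = \<i> * complex_of_real (\<alpha> \<bullet> \<xi>) - P \<xi> + \<Upsilon> \<xi>;
       \<Upsilon> \<in> o[at 0](\<lambda>\<xi>. complex_of_real (R \<xi>))\<rbrakk>
     \<Longrightarrow> \<exists>r>0. \<forall>\<xi> \<nu>. norm \<xi> < r \<longrightarrow> norm \<nu> < r \<longrightarrow>
       cmod (fourier (tilt \<nu> \<phi>) (\<xi>0 + \<xi>)) \<le> exp (\<alpha> \<bullet> \<nu> - R \<xi> / 4 + M * R \<nu>)"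
proof -
  obtain N K where N: "N > 0" and K: "K > 0" "\<And>x. R x \<le> 1 \<Longrightarrow> norm x ^ N \<le> K * R x"
    using norm_power_le_R by metis
  obtain c where c: "\<And>p. degree p \<le> N \<Longrightarrow> (\<Sum>k\<le>N. c k * poly p (of_nat k)) = poly p (- \<i>)"
    using interpolation_weights_exist[of N "- \<i>"] by blast
  obtain K1 where K1: "K1 > 0"
    "\<And>g r. \<lbrakk>g holomorphic_on ball 0 r; r \<ge> 4 * real (Suc N); \<And>z. cmod z < r \<Longrightarrow> cmod (g z) \<le> 1\<rbrakk>
           \<Longrightarrow> cmod (g (- \<i>) - (\<Sum>k\<le>N. c k * g (of_nat k))) \<le> K1 / r ^ Suc N"
    using interpolation_error_bounded_holomorphic[of "- \<i>" N c, OF _ c] by auto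
  have c1: "(\<Sum>k\<le>N. c k) = 1" using c[of 1] by simp
  have lin: "linear (T t)" if "t > 0" for t using that by (rule linear_T)
  have T_line: "T t (\<xi> + a *\<^sub>R \<nu>) = T t \<xi> + a *\<^sub>R T t \<nu>" if "t > 0" for t \<xi> a \<nu>
    using lin[OF that] by (simp add: linear_add linear_scale)
  have cont_line: "continuous_on UNIV (\<lambda>p :: (real ^ 'd) \<times> (real ^ 'd). P (fst p + real k *\<^sub>R snd p))" for k
    by (rule continuous_on_compose2[OF continuous_P]) (auto intro!: continuous_intros)
  (* The interpolated value of P at the frequency \<xi> - \<i> \<nu>. *)
  define Q where "Q \<xi> \<nu> = (\<Sum>k\<le>N. c k * P (\<xi> + real k *\<^sub>R \<nu>))" for \<xi> \<nu>
  have "continuous_on UNIV (\<lambda>p. Re (Q (fst p) (snd p)))"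
    unfolding Q_def by (intro continuous_intros cont_line)
  moreover have "Re (Q (T t x) (T t y)) = t * Re (Q x y)" if "t > 0" for t x y
  proof -
    have "Q (T t x) (T t y) = (\<Sum>k\<le>N. complex_of_real t * (c k * P (x + real k *\<^sub>R y)))"
      unfolding Q_def by (intro sum.cong refl) (simp add: T_line[OF that, symmetric] P_T[OF that])
    then show ?thesis by (simp add: Q_def sum_distrib_left[symmetric])
  qed
  moreover have "Re (Q x 0) = R x" for x
    using c1 by (simp add: Q_def sum_distrib_right[symmetric])
  ultimately obtain M where M: "M > 0" "\<And>x y. R x / 2 - M * R y \<le> Re (Q x y)"
    using homogeneous_lower_bound[of "\<lambda>x y. Re (Q x y)"] by blast
  (* The weights c k have no sign, so the remainders are measured with their absolute values. *)
  define W where "W \<xi> \<nu> = (\<Sum>k\<le>N. cmod (c k) * R (\<xi> + real k *\<^sub>R \<nu>))" for \<xi> \<nu>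
  have "continuous_on UNIV (\<lambda>p. W (fst p) (snd p))"
    unfolding W_def by (intro continuous_intros cont_line)
  moreover have "W (T t x) (T t y) = t * W x y" if "t > 0" for t x y
    unfolding W_def sum_distrib_left
    by (intro sum.cong refl) (simp add: T_line[OF that, symmetric] R_T[OF that])
  ultimately obtain C where C: "C > 0" "\<And>x y. \<bar>W x y\<bar> \<le> C * (R x + R y)"
    using homogeneous_bound[of W] by blast
  show ?thesis
  proof (rule that[of "M + 1"])
    show "M + 1 > 0" using M by simp
    fix \<phi> :: "int ^ 'd \<Rightarrow> complex" and \<xi>0 \<alpha> :: "real ^ 'd" and U \<Upsilon>
    assume fin: "finite {x. \<phi> x \<noteq> 0}" and f1: "cmod (fourier \<phi> \<xi>0) = 1" and U: "open U" "0 \<in> U"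
      and expand: "\<And>\<xi>. \<xi> \<in> U \<Longrightarrow> Gamma_log \<phi> \<xi>0 \<xi> = \<i> * complex_of_real (\<alpha> \<bullet> \<xi>) - P \<xi> + \<Upsilon> \<xi>"
      and small: "\<Upsilon> \<in> o[at 0](\<lambda>\<xi>. complex_of_real (R \<xi>))"
    define f0 where "f0 = fourier \<phi> \<xi>0"
    have f0: "f0 \<noteq> 0" using f1 by (auto simp: f0_def)
    (* H is the normalised Fourier transform at \<xi>0 + \<xi> - \<i> \<nu>; it is 1 at the origin, so Ln H is defined and bounded by 1 nearby. *)
    define H where "H p = fourier (tilt (snd p) \<phi>) (\<xi>0 + fst p) / f0" for p
    have "continuous_on UNIV H"
      unfolding H_def
      by (intro continuous_intros continuous_on_compose2[OF continuous_fourier_tilt[OF fin], of _ "\<lambda>p. (\<xi>0 + fst p, snd p)", simplified])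
        (use f0 in auto)
    then have "isCont H (0, 0)" by (simp add: continuous_on_eq_continuous_at)
    then have "(H \<longlongrightarrow> H (0, 0)) (nhds (0, 0))"
      unfolding isCont_def tendsto_at_iff_tendsto_nhds .
    moreover have "H (0, 0) = 1" using f0 by (simp add: H_def tilt_zero f0_def)
    ultimately have H_lim: "(H \<longlongrightarrow> 1) (nhds (0, 0))" by simp
    have "isCont Ln 1" by (rule continuous_at_Ln) simp
    then have "(Ln \<longlongrightarrow> 0) (nhds 1)"
      unfolding isCont_def tendsto_at_iff_tendsto_nhds by simp
    then have "((\<lambda>p. Ln (H p)) \<longlongrightarrow> 0) (nhds (0, 0))"
      using H_lim by (rule filterlim_compose)
    then have "\<forall>\<^sub>F p in nhds (0, 0). dist (Ln (H p)) 0 < 1" by (rule tendstoD) simp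
    moreover have "\<forall>\<^sub>F p in nhds (0, 0). dist (H p) 1 < 1" using H_lim by (rule tendstoD) simp
    ultimately have "\<forall>\<^sub>F p in nhds (0, 0). cmod (Ln (H p)) < 1 \<and> dist (H p) 1 < 1"
      by eventually_elim simp
    then obtain \<delta> where \<delta>: "\<delta> > 0"
      "\<And>p. dist p (0, 0) < \<delta> \<Longrightarrow> cmod (Ln (H p)) < 1 \<and> dist (H p) 1 < 1"
      unfolding eventually_nhds_metric by blast
    have near: "cmod (Ln (H (\<xi>, \<nu>))) < 1 \<and> dist (H (\<xi>, \<nu>)) 1 < 1" if "norm \<xi> + norm \<nu> < \<delta>" for \<xi> \<nu>
    proof (rule \<delta>(2))
      have "dist (\<xi>, \<nu>) (0, 0) \<le> norm \<xi> + norm \<nu>"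
        by (simp add: dist_norm norm_Pair_le)
      then show "dist (\<xi>, \<nu>) (0, 0) < \<delta>" using that by simp
    qed
    (* With this \<eta> the remainders at the nodes add up to at most a quarter of R \<xi> + R \<nu>. *)
    define \<eta> where "\<eta> = 1 / (4 * C)"
    have \<eta>: "\<eta> > 0" using C by (simp add: \<eta>_def)
    have "\<forall>\<^sub>F \<xi> in at 0. cmod (\<Upsilon> \<xi>) \<le> \<eta> * cmod (complex_of_real (R \<xi>))"
      by (rule landau_o.smallD[OF small \<eta>])
    then obtain d1 where d1: "d1 > 0"
      "\<And>\<xi>. \<xi> \<noteq> 0 \<Longrightarrow> dist \<xi> 0 < d1 \<Longrightarrow> cmod (\<Upsilon> \<xi>) \<le> \<eta> * cmod (complex_of_real (R \<xi>))"
      unfolding eventually_at by blast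
    have \<Upsilon>0: "\<Upsilon> 0 = 0" using expand[OF U(2)] f0 by (simp add: Gamma_log_def f0_def P_0)
    have \<Upsilon>: "cmod (\<Upsilon> \<xi>) \<le> \<eta> * R \<xi>" if "norm \<xi> < d1" for \<xi>
      using d1(2)[of \<xi>] that R_nonneg[of \<xi>] \<Upsilon>0 R_0 by (cases "\<xi> = 0") auto
    obtain d2 where d2: "d2 > 0" "ball 0 d2 \<subseteq> U" using U open_contains_ball by blast
    have "\<exists>d3>0. \<forall>\<nu>. norm \<nu> < d3 \<longrightarrow> R \<nu> \<le> 1"
    proof -
      have "isCont (\<lambda>\<nu>. R \<nu>) 0" using continuous_R by (simp add: continuous_on_eq_continuous_at)
      then obtain d where "d > 0" "\<And>y. dist y 0 < d \<Longrightarrow> dist (R y) (R 0) < 1"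
        unfolding continuous_at_eps_delta dist_norm by (metis zero_less_one)
      then show ?thesis by (intro exI[of _ d]) (force simp: dist_real_def R_0)
    qed
    then obtain d3 where d3: "d3 > 0" "\<And>\<nu>. norm \<nu> < d3 \<Longrightarrow> R \<nu> \<le> 1" by blast
    define K2 where "K2 = K1 * (4 / \<delta>) ^ Suc N"
    have K2: "K2 > 0" using K1 \<delta> by (simp add: K2_def)
    define L where "L = real (Suc N)"
    have L: "L > 0" "L \<ge> 1" by (simp_all add: L_def)
    (* The entries of the minimum serve, in this order, to keep the disc of analyticity large enough for interpolation,
       to keep the nodes inside the region where \<Upsilon> is small and inside U, to have R \<nu> \<le> 1,
       and to bound the interpolation error by R \<nu> / 2. *)
    define r where "r = Min {\<delta> / (16 * L), d1 / L, d2 / L, d3, 1 / (2 * K * K2)}"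
    have r0: "r > 0" using \<delta> d1 d2 d3 K K2 L by (simp add: r_def)
    have r_le: "r \<le> \<delta> / (16 * L)" "r \<le> d1 / L" "r \<le> d2 / L" "r \<le> d3" "r \<le> 1 / (2 * K * K2)"
      unfolding r_def by (rule Min_le; simp)+
    have "cmod (fourier (tilt \<nu> \<phi>) (\<xi>0 + \<xi>)) \<le> exp (\<alpha> \<bullet> \<nu> - R \<xi> / 4 + (M + 1) * R \<nu>)"
      if \<xi>: "norm \<xi> < r" and \<nu>: "norm \<nu> < r" for \<xi> \<nu>
    proof -
      have Lr: "L * r \<le> d1" "L * r \<le> d2" "16 * L * r \<le> \<delta>"
        using r_le L by (simp_all add: field_simps)
      have "1 * (16 * r) \<le> L * (16 * r)" by (rule mult_right_mono) (use L r0 in auto)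
      also have "\<dots> = 16 * L * r" by simp
      also note Lr(3)
      finally have r16: "16 * r \<le> \<delta>" by simp
      define G where "G s = H (\<xi> + Re s *\<^sub>R \<nu>, - Im s *\<^sub>R \<nu>)" for s
      define g where "g s = Ln (G s)" for s
      have G_eq: "G s = (\<Sum>x\<in>{x. \<phi> x \<noteq> 0}. \<phi> x * exp (\<i> * (complex_of_real (real_vec x \<bullet> (\<xi>0 + \<xi>)) + s * complex_of_real (real_vec x \<bullet> \<nu>)))) / f0" for s
        using fourier_tilt_line[OF fin order_refl, of s \<nu> "\<xi>0 + \<xi>"] by (simp add: G_def H_def add.assoc)
      have G_near: "cmod (g s) < 1 \<and> dist (G s) 1 < 1" if s: "cmod s * norm \<nu> < \<delta> / 4" for s
        unfolding g_def G_def
      proof (rule near)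
        have "norm \<xi> < \<delta> / 4" using \<xi> \<delta> r16 by simp
        moreover have "norm (\<xi> + Re s *\<^sub>R \<nu>) \<le> norm \<xi> + cmod s * norm \<nu>"
          by (rule order_trans[OF norm_triangle_ineq]) (simp add: mult_right_mono abs_Re_le_cmod)
        moreover have "norm (- Im s *\<^sub>R \<nu>) \<le> cmod s * norm \<nu>"
          by (simp add: mult_right_mono abs_Im_le_cmod)
        ultimately show "norm (\<xi> + Re s *\<^sub>R \<nu>) + norm (- Im s *\<^sub>R \<nu>) < \<delta>" using s \<delta>(1) by linarith
      qed
      have g_hol: "g holomorphic_on ball 0 \<rho>" if "\<rho> * norm \<nu> \<le> \<delta> / 4" for \<rho>
      proof -
        have "G s \<notin> \<real>\<^sub>\<le>\<^sub>0" if "s \<in> ball 0 \<rho>" for s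
        proof -
          have "cmod s * norm \<nu> < \<delta> / 4"
          proof (cases "\<nu> = 0")
            case False
            then have "cmod s * norm \<nu> < \<rho> * norm \<nu>" using that by simp
            then show ?thesis using \<open>\<rho> * norm \<nu> \<le> \<delta> / 4\<close> by simp
          qed (use \<delta> in simp)
          then have "dist (G s) 1 < 1" using G_near by blast
          then show ?thesis
            using complex_nonpos_Reals_iff abs_Re_le_cmod[of "G s - 1"] by (force simp: dist_norm)
        qed
        then show ?thesis unfolding g_def G_eq[abs_def]
          by (intro holomorphic_intros) (auto simp: f0)
      qed
      have err: "cmod (g (- \<i>) - (\<Sum>k\<le>N. c k * g (of_nat k))) \<le> K2 * norm \<nu> ^ Suc N"
      proof (cases "\<nu> = 0")
        case True
        then have const: "g s = Ln (H (\<xi>, 0))" for s by (simp add: g_def G_def)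
        have "(\<Sum>k\<le>N. c k * g (of_nat k)) = g (- \<i>)"
          unfolding const sum_distrib_right[symmetric] c1 by simp
        then show ?thesis using K2 by simp
      next
        case False
        (* On the disc of this radius the line stays inside the region where Ln H is bounded by 1. *)
        define \<rho> where "\<rho> = \<delta> / (4 * norm \<nu>)"
        have \<rho>: "\<rho> * norm \<nu> = \<delta> / 4" using False by (simp add: \<rho>_def)
        have "16 * L * norm \<nu> \<le> 16 * L * r" using \<nu> L by (intro mult_left_mono) auto
        also note Lr(3)
        finally have "16 * L * norm \<nu> \<le> \<delta>" .
        then have "4 * L \<le> \<rho>" using False by (simp add: \<rho>_def field_simps)
        moreover have "cmod (g z) \<le> 1" if "cmod z < \<rho>" for z
        proof -
          have "cmod z * norm \<nu> < \<rho> * norm \<nu>" using that False by simp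
          then show ?thesis using G_near[of z] \<rho> by simp
        qed
        ultimately have "cmod (g (- \<i>) - (\<Sum>k\<le>N. c k * g (of_nat k))) \<le> K1 / \<rho> ^ Suc N"
          using g_hol[of \<rho>] \<rho> unfolding L_def by (intro K1(2)) auto
        also have "\<dots> = K2 * norm \<nu> ^ Suc N"
          using False \<delta> by (simp add: \<rho>_def K2_def power_divide power_mult_distrib del: power_Suc)
        finally show ?thesis .
      qed
      have node: "norm (\<xi> + real k *\<^sub>R \<nu>) < L * r" if "k \<le> N" for k
      proof -
        have "norm (\<xi> + real k *\<^sub>R \<nu>) \<le> norm \<xi> + real k * norm \<nu>"
          by (rule order_trans[OF norm_triangle_ineq]) simp
        also have "\<dots> < r + real k * r" using \<xi> \<nu> by (intro add_less_le_mono mult_left_mono) auto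
        also have "\<dots> \<le> L * r" using that r0 by (simp add: L_def ring_distribs mult_right_mono)
        finally show ?thesis .
      qed
      have g_node: "g (of_nat k) = \<i> * complex_of_real (\<alpha> \<bullet> \<xi>) + \<i> * complex_of_real (\<alpha> \<bullet> \<nu>) * of_nat k
           - P (\<xi> + real k *\<^sub>R \<nu>) + \<Upsilon> (\<xi> + real k *\<^sub>R \<nu>)" if "k \<le> N" for k
      proof -
        have "\<xi> + real k *\<^sub>R \<nu> \<in> U" using node[OF that] Lr d2 by auto
        from expand[OF this] show ?thesis
          by (simp add: g_def G_def H_def Gamma_log_def tilt_zero f0_def add_ac inner_add_right algebra_simps)
      qed
      have sum_eq: "(\<Sum>k\<le>N. c k * g (of_nat k)) = \<i> * complex_of_real (\<alpha> \<bullet> \<xi>) + complex_of_real (\<alpha> \<bullet> \<nu>)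
         - Q \<xi> \<nu> + (\<Sum>k\<le>N. c k * \<Upsilon> (\<xi> + real k *\<^sub>R \<nu>))"
      proof -
        let ?p = "[:\<i> * complex_of_real (\<alpha> \<bullet> \<xi>), \<i> * complex_of_real (\<alpha> \<bullet> \<nu>):]"
        have "degree ?p \<le> N" using N by (intro order_trans[OF degree_pCons_le]) simp
        from c[OF this] have "(\<Sum>k\<le>N. c k * poly ?p (of_nat k)) = \<i> * complex_of_real (\<alpha> \<bullet> \<xi>) + complex_of_real (\<alpha> \<bullet> \<nu>)"
          by simp
        moreover have "(\<Sum>k\<le>N. c k * g (of_nat k)) = (\<Sum>k\<le>N. c k * poly ?p (of_nat k)
           - c k * P (\<xi> + real k *\<^sub>R \<nu>) + c k * \<Upsilon> (\<xi> + real k *\<^sub>R \<nu>))"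
          by (intro sum.cong refl) (simp add: g_node algebra_simps)
        ultimately show ?thesis by (simp add: sum.distrib sum_subtractf Q_def)
      qed
      have rem: "cmod (\<Sum>k\<le>N. c k * \<Upsilon> (\<xi> + real k *\<^sub>R \<nu>)) \<le> (R \<xi> + R \<nu>) / 4"
      proof -
        have "cmod (\<Sum>k\<le>N. c k * \<Upsilon> (\<xi> + real k *\<^sub>R \<nu>)) \<le> (\<Sum>k\<le>N. cmod (c k) * (\<eta> * R (\<xi> + real k *\<^sub>R \<nu>)))"
        proof (rule sum_norm_le)
          fix k assume "k \<in> {..N}"
          then have "norm (\<xi> + real k *\<^sub>R \<nu>) < d1" using node[of k] Lr by auto
          then show "cmod (c k * \<Upsilon> (\<xi> + real k *\<^sub>R \<nu>)) \<le> cmod (c k) * (\<eta> * R (\<xi> + real k *\<^sub>R \<nu>))"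
            unfolding norm_mult by (intro mult_left_mono \<Upsilon>) auto
        qed
        also have "\<dots> = \<eta> * W \<xi> \<nu>" by (simp add: W_def sum_distrib_left mult_ac)
        also have "\<dots> \<le> \<eta> * (C * (R \<xi> + R \<nu>))"
          using C(2)[of \<xi> \<nu>] \<eta> by (intro mult_left_mono) auto
        also have "\<dots> = (R \<xi> + R \<nu>) / 4" using C by (simp add: \<eta>_def)
        finally show ?thesis .
      qed
      have tail: "K2 * norm \<nu> ^ Suc N \<le> R \<nu> / 2"
      proof -
        have "R \<nu> \<le> 1" using d3 \<nu> r_le by simp
        then have "norm \<nu> ^ N \<le> K * R \<nu>" by (rule K(2))
        moreover have "norm \<nu> \<le> 1 / (2 * K * K2)" using \<nu> r_le by simp
        ultimately have "norm \<nu> * norm \<nu> ^ N \<le> 1 / (2 * K * K2) * (K * R \<nu>)"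
          using K K2 by (intro mult_mono) auto
        then have "K2 * (norm \<nu> * norm \<nu> ^ N) \<le> K2 * (1 / (2 * K * K2) * (K * R \<nu>))"
          using K2 by (intro mult_left_mono) auto
        then show ?thesis using K K2 by simp
      qed
      have "Re (g (- \<i>)) \<le> Re (\<Sum>k\<le>N. c k * g (of_nat k)) + K2 * norm \<nu> ^ Suc N"
        using complex_Re_le_cmod[of "g (- \<i>) - (\<Sum>k\<le>N. c k * g (of_nat k))"] err by simp
      also have "\<dots> \<le> \<alpha> \<bullet> \<nu> - Re (Q \<xi> \<nu>) + (R \<xi> + R \<nu>) / 4 + R \<nu> / 2"
      proof -
        have "Re (\<Sum>k\<le>N. c k * g (of_nat k))
            = \<alpha> \<bullet> \<nu> - Re (Q \<xi> \<nu>) + Re (\<Sum>k\<le>N. c k * \<Upsilon> (\<xi> + real k *\<^sub>R \<nu>))"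
          unfolding sum_eq by simp
        then show ?thesis
          using complex_Re_le_cmod[of "\<Sum>k\<le>N. c k * \<Upsilon> (\<xi> + real k *\<^sub>R \<nu>)"] rem tail by linarith
      qed
      also have "\<dots> \<le> \<alpha> \<bullet> \<nu> - R \<xi> / 4 + (M + 1) * R \<nu>"
      proof -
        have "x - q + (a + b) / 4 + b / 2 \<le> x - a / 4 + (m + b)" if "a / 2 - m \<le> q" "0 \<le> b" for x q a b m :: real
          using that by (simp add: field_simps)
        from this[OF M(2) R_nonneg] show ?thesis by (simp add: distrib_right)
      qed
      finally have Re_g: "Re (g (- \<i>)) \<le> \<alpha> \<bullet> \<nu> - R \<xi> / 4 + (M + 1) * R \<nu>" .
      have "cmod (- \<i>) * norm \<nu> < \<delta> / 4"
        using \<nu> \<delta> r16 by simp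
      then have "dist (G (- \<i>)) 1 < 1" using G_near by blast
      then have "G (- \<i>) \<noteq> 0" by (auto simp: dist_norm)
      then have "exp (g (- \<i>)) = G (- \<i>)" by (simp add: g_def)
      then have "exp (Re (g (- \<i>))) = cmod (G (- \<i>))" by (metis norm_exp_eq_Re)
      moreover have "cmod (G (- \<i>)) = cmod (fourier (tilt \<nu> \<phi>) (\<xi>0 + \<xi>))"
        using f1 by (simp add: G_def H_def norm_divide f0_def)
      ultimately show ?thesis using Re_g by (metis exp_le_cancel_iff)
    qed
    then show "\<exists>r>0. \<forall>\<xi> \<nu>. norm \<xi> < r \<longrightarrow> norm \<nu> < r \<longrightarrow>
       cmod (fourier (tilt \<nu> \<phi>) (\<xi>0 + \<xi>)) \<le> exp (\<alpha> \<bullet> \<nu> - R \<xi> / 4 + (M + 1) * R \<nu>)"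
      using r0 by blast
  qed
qed

end

lemma complex_homogeneous_flow_powr_matrix:
  fixes P :: "real ^ 'd::finite \<Rightarrow> complex"
  assumes cont: "continuous_on UNIV P" and pos: "positive_definite_fun (\<lambda>\<xi>. Re (P \<xi>))"
    and E: "E \<in> Exp_set P"
  shows "complex_homogeneous_flow P (\<lambda>t \<xi>. powr_matrix t E *v \<xi>)"
proof
  show "continuous_on UNIV (\<lambda>\<xi>. Re (P \<xi>))" using cont by (intro continuous_intros)
  show "continuous_on {0<..} (\<lambda>t. powr_matrix t E *v x)" for x
    unfolding matrix_vector_mult_def
    by (intro continuous_intros continuous_on_powr_matrix)
  show P_T: "P (powr_matrix t E *v x) = complex_of_real t * P x" if "t > 0" for t x
    using E that by (simp add: Exp_set_def)
  show "Re (P (powr_matrix t E *v x)) = t * Re (P x)" if "t > 0" for t x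
    using P_T[OF that] by simp
qed (use cont pos in \<open>auto simp: positive_definite_fun_def powr_matrix_one powr_matrix_mult
    matrix_vector_mul_assoc linear_add[OF matrix_vector_mul_linear] linear_scale[OF matrix_vector_mul_linear]\<close>)

context complex_homogeneous_flow
begin

text \<open>Three regimes. For small \<open>\<nu>\<close> and \<open>\<xi>\<close> near one of finitely many maxima, the local estimate applies. For
small \<open>\<nu>\<close> and \<open>\<xi>\<close> away from the maxima, compactness gives a gap \<open>\<kappa>\<close>. For the remaining \<open>\<nu>\<close> the
crude exponential bound suffices, since \<open>R\<close> grows at least linearly away from the origin and hence
dominates \<open>norm \<nu>\<close>, the drift term and the constant \<open>\<kappa>\<close> after multiplication by a large \<open>M\<close>.\<close>

lemma global_estimate:
  fixes \<phi> :: "int ^ 'd \<Rightarrow> complex" and \<alpha> :: "real ^ 'd"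
  assumes flat: "((\<lambda>\<xi>. R \<xi>) has_derivative (\<lambda>_. 0)) (at 0)"
    and fin: "finite {x. \<phi> x \<noteq> 0}"
    and le1: "\<And>\<xi>. cmod (fourier \<phi> \<xi>) \<le> 1"
    and type: "\<And>\<xi>0. cmod (fourier \<phi> \<xi>0) = 1 \<Longrightarrow> positive_homogeneous_type \<phi> \<xi>0 \<alpha> P"
  obtains M \<kappa> D where "M > 0" "\<kappa> > 0" "finite D"
    "\<And>\<nu> \<xi>. \<xi> \<in> period_box \<Longrightarrow>
       cmod (fourier (tilt \<nu> \<phi>) \<xi>) \<le> exp (\<alpha> \<bullet> \<nu> + M * R \<nu> - \<kappa>) \<or>
       (\<exists>a\<in>D. cmod (fourier (tilt \<nu> \<phi>) \<xi>) \<le> exp (\<alpha> \<bullet> \<nu> + M * R \<nu> - R (\<xi> - a) / 4))"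
proof -
  obtain M1 where M1: "M1 > 0" and M1_local:
    "\<And>\<phi> \<xi>0 \<alpha> U \<Upsilon>. \<lbrakk>finite {x. \<phi> x \<noteq> 0}; cmod (fourier \<phi> \<xi>0) = 1; open U; 0 \<in> U;
       \<And>\<xi>. \<xi> \<in> U \<Longrightarrow> Gamma_log \<phi> \<xi>0 \<xi> = \<i> * complex_of_real (\<alpha> \<bullet> \<xi>) - P \<xi> + \<Upsilon> \<xi>;
       \<Upsilon> \<in> o[at 0](\<lambda>\<xi>. complex_of_real (R \<xi>))\<rbrakk>
     \<Longrightarrow> \<exists>r>0. \<forall>\<xi> \<nu>. norm \<xi> < r \<longrightarrow> norm \<nu> < r \<longrightarrow>
       cmod (fourier (tilt \<nu> \<phi>) (\<xi>0 + \<xi>)) \<le> exp (\<alpha> \<bullet> \<nu> - R \<xi> / 4 + M1 * R \<nu>)"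
    using local_estimate by blast
  define A where "A = {\<xi> \<in> period_box. cmod (fourier \<phi> \<xi>) = 1}"
  have cont: "continuous_on S (\<lambda>\<xi>. cmod (fourier \<phi> \<xi>))" for S
    by (intro continuous_intros continuous_on_fourier fin)
  have "\<exists>r>0. \<forall>\<xi> \<nu>. norm \<xi> < r \<longrightarrow> norm \<nu> < r \<longrightarrow>
       cmod (fourier (tilt \<nu> \<phi>) (a + \<xi>)) \<le> exp (\<alpha> \<bullet> \<nu> - R \<xi> / 4 + M1 * R \<nu>)" if a: "a \<in> A" for a
  proof -
    have a1: "cmod (fourier \<phi> a) = 1" using a by (simp add: A_def)
    then obtain U \<Upsilon> where "open U" "0 \<in> U"
      "\<And>\<xi>. \<xi> \<in> U \<Longrightarrow> Gamma_log \<phi> a \<xi> = \<i> * complex_of_real (\<alpha> \<bullet> \<xi>) - P \<xi> + \<Upsilon> \<xi>"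
      "\<Upsilon> \<in> o[at 0](\<lambda>\<xi>. complex_of_real (R \<xi>))"
      using type[OF a1] unfolding positive_homogeneous_type_def by blast
    from M1_local[OF fin a1 this] show ?thesis .
  qed
  then have "\<forall>a\<in>A. \<exists>r. r > 0 \<and> (\<forall>\<xi> \<nu>. norm \<xi> < r \<longrightarrow> norm \<nu> < r \<longrightarrow>
       cmod (fourier (tilt \<nu> \<phi>) (a + \<xi>)) \<le> exp (\<alpha> \<bullet> \<nu> - R \<xi> / 4 + M1 * R \<nu>))" by blast
  from bchoice[OF this] obtain r where r: "\<And>a. a \<in> A \<Longrightarrow> r a > 0"
    "\<And>a \<xi> \<nu>. a \<in> A \<Longrightarrow> norm \<xi> < r a \<Longrightarrow> norm \<nu> < r a \<Longrightarrow>
       cmod (fourier (tilt \<nu> \<phi>) (a + \<xi>)) \<le> exp (\<alpha> \<bullet> \<nu> - R \<xi> / 4 + M1 * R \<nu>)"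
    by blast
  have cbx: "compact (period_box :: (real ^ 'd) set)" unfolding period_box_eq_cbox by simp
  have "closed {\<xi> :: real ^ 'd. cmod (fourier \<phi> \<xi>) = 1}"
    by (rule closed_Collect_eq[OF cont continuous_on_const])
  from compact_Int_closed[OF cbx this] have "compact A" by (simp add: A_def Collect_conj_eq)
  then obtain D where D: "D \<subseteq> A" "finite D" "A \<subseteq> (\<Union>a\<in>D. ball a (r a))"
    using r(1) by (elim compactE_image[where C = A and f = "\<lambda>a. ball a (r a)"]) force+
  define W where "W = (\<Union>a\<in>D. ball a (r a))"
  define r0 where "r0 = Min (insert 1 (r ` D))"
  have r0: "r0 > 0" using D r(1) by (auto simp: r0_def)
  have r0_le: "r0 \<le> r a" if "a \<in> D" for a using D that by (simp add: r0_def)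
  have "\<exists>m. 0 \<le> m \<and> m < 1 \<and> (\<forall>\<xi>\<in>period_box - W. cmod (fourier \<phi> \<xi>) \<le> m)"
  proof (cases "period_box - W = {}")
    case True then show ?thesis by (intro exI[of _ 0]) auto
  next
    case False
    have "compact (period_box - W)" using cbx by (rule compact_diff) (auto simp: W_def)
    from continuous_attains_sup[OF this False cont] obtain z where z: "z \<in> period_box - W" "\<And>y. y \<in> period_box - W \<Longrightarrow> cmod (fourier \<phi> y) \<le> cmod (fourier \<phi> z)"
      by blast
    then have "z \<notin> A" using D by (auto simp: W_def)
    then have "cmod (fourier \<phi> z) \<noteq> 1" using z by (simp add: A_def)
    then show ?thesis using le1[of z] z by (intro exI[of _ "cmod (fourier \<phi> z)"]) auto
  qed
  then obtain m where m: "0 \<le> m" "m < 1" "\<And>\<xi>. \<xi> \<in> period_box - W \<Longrightarrow> cmod (fourier \<phi> \<xi>) \<le> m" by blast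
  (* exp (- \<kappa>) lies half way between the bound m away from W and 1, which leaves room for the tilt. *)
  define \<kappa> where "\<kappa> = - ln ((m + 1) / 2)"
  have \<kappa>: "\<kappa> > 0" "exp (- \<kappa>) = (m + 1) / 2" using m by (simp_all add: \<kappa>_def ln_less_zero)
  (* q bounds the tilted transform away from W, after removal of the drift factor. *)
  define q where "q \<nu> = (m + (\<Sum>x\<in>{x. \<phi> x \<noteq> 0}. cmod (\<phi> x) * \<bar>exp (real_vec x \<bullet> \<nu>) - 1\<bar>)) * exp (- (\<alpha> \<bullet> \<nu>))" for \<nu>
  have "continuous_on UNIV q" unfolding q_def by (intro continuous_intros)
  then have "isCont q 0" by (simp add: continuous_on_eq_continuous_at)
  moreover have "q 0 = m" by (simp add: q_def)
  moreover have "(1 - m) / 2 > 0" using m by simp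
  ultimately obtain r1 where r1: "r1 > 0" "\<And>\<nu>. dist \<nu> 0 < r1 \<Longrightarrow> dist (q \<nu>) m < (1 - m) / 2"
    unfolding continuous_at_eps_delta dist_norm by metis
  define r2 where "r2 = min r0 r1"
  have r2: "r2 > 0" using r0 r1 by (simp add: r2_def)
  obtain a b where ab: "a \<ge> 0" "b \<ge> 0" "\<And>\<nu> \<xi>. cmod (fourier (tilt \<nu> \<phi>) \<xi>) \<le> exp (a + b * norm \<nu>)"
    using norm_fourier_tilt_le_exp[OF fin] by metis
  obtain c where c: "c > 0" "\<And>x. norm x \<ge> r2 \<Longrightarrow> R x \<ge> c * norm x"
    using R_linear_growth[OF flat r2] by metis
  (* On norm \<nu> \<ge> r2 the constant a + \<kappa> is at most (a + \<kappa>) / r2 times norm \<nu>, and c * norm \<nu> \<le> R \<nu>. *)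
  define M2 where "M2 = (b + norm \<alpha> + (a + \<kappa>) / r2) / c"
  define M where "M = max M1 M2"
  have M: "M > 0" "M1 \<le> M" "M2 \<le> M" using M1 by (auto simp: M_def)
  have "cmod (fourier (tilt \<nu> \<phi>) \<xi>) \<le> exp (\<alpha> \<bullet> \<nu> + M * R \<nu> - \<kappa>) \<or>
       (\<exists>a\<in>D. cmod (fourier (tilt \<nu> \<phi>) \<xi>) \<le> exp (\<alpha> \<bullet> \<nu> + M * R \<nu> - R (\<xi> - a) / 4))"
    if \<xi>: "\<xi> \<in> period_box" for \<nu> \<xi>
  proof (cases "norm \<nu> < r2")
    case small: True
    show ?thesis
    proof (cases "\<xi> \<in> W")
      case True
      then obtain a where aD: "a \<in> D" and "\<xi> \<in> ball a (r a)" by (auto simp: W_def)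
      then have "norm (\<xi> - a) < r a" by (simp add: dist_norm norm_minus_commute)
      moreover have "norm \<nu> < r a" using small r0_le[OF aD] by (simp add: r2_def)
      ultimately have "cmod (fourier (tilt \<nu> \<phi>) (a + (\<xi> - a))) \<le> exp (\<alpha> \<bullet> \<nu> - R (\<xi> - a) / 4 + M1 * R \<nu>)"
        using aD D by (intro r(2)) auto
      also have "\<dots> \<le> exp (\<alpha> \<bullet> \<nu> + M * R \<nu> - R (\<xi> - a) / 4)"
        using mult_right_mono[OF M(2) R_nonneg[of \<nu>]] by simp
      finally have "cmod (fourier (tilt \<nu> \<phi>) \<xi>) \<le> exp (\<alpha> \<bullet> \<nu> + M * R \<nu> - R (\<xi> - a) / 4)" by simp
      then show ?thesis using aD by blast
    next
      case False
      have "dist (q \<nu>) m < (1 - m) / 2" using r1(2) small by (simp add: r2_def)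
      then have "q \<nu> \<le> exp (- \<kappa>)" unfolding \<kappa>(2) dist_real_def by argo
      then have qe: "q \<nu> * exp (\<alpha> \<bullet> \<nu>) \<le> exp (- \<kappa>) * exp (\<alpha> \<bullet> \<nu>)" by (intro mult_right_mono) auto
      have "cmod (fourier (tilt \<nu> \<phi>) \<xi>) \<le> q \<nu> * exp (\<alpha> \<bullet> \<nu>)"
        using norm_fourier_tilt_le[OF fin, of \<nu> \<xi>] m(3)[of \<xi>] False \<xi>
        by (simp add: q_def mult.assoc exp_add[symmetric])
      also have "\<dots> \<le> exp (\<alpha> \<bullet> \<nu> - \<kappa>)" using qe by (simp add: exp_diff exp_minus field_simps)
      also have "\<dots> \<le> exp (\<alpha> \<bullet> \<nu> + M * R \<nu> - \<kappa>)" using M R_nonneg[of \<nu>] by simp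
      finally show ?thesis by blast
    qed
  next
    case False
    then have big: "norm \<nu> \<ge> r2" by simp
    have "a + \<kappa> \<le> (a + \<kappa>) / r2 * norm \<nu>"
      using big r2 ab \<kappa> mult_left_mono[of r2 "norm \<nu>" "(a + \<kappa>) / r2"] by simp
    moreover have "- (norm \<alpha> * norm \<nu>) \<le> \<alpha> \<bullet> \<nu>"
      using Cauchy_Schwarz_ineq2[of \<alpha> \<nu>] by (simp add: abs_le_iff)
    moreover have "(b + norm \<alpha> + (a + \<kappa>) / r2) * norm \<nu> = M2 * (c * norm \<nu>)"
      using c by (simp add: M2_def)
    moreover have "M2 * (c * norm \<nu>) \<le> M * R \<nu>"
      using M c(2)[OF big] c(1) by (intro mult_mono) auto
    ultimately have "a + b * norm \<nu> \<le> \<alpha> \<bullet> \<nu> + M * R \<nu> - \<kappa>"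
      by (simp only: distrib_right)
    then have "exp (a + b * norm \<nu>) \<le> exp (\<alpha> \<bullet> \<nu> + M * R \<nu> - \<kappa>)" by simp
    with ab(3) show ?thesis using order_trans by blast
  qed
  then show ?thesis using that[OF M(1) \<kappa>(1) D(2)] by blast
qed

end

section \<open>From the frequency estimate to convolution powers\<close>

context complex_homogeneous_flow
begin

lemma integral_exp_R_finite:
  assumes flat: "((\<lambda>\<xi>. R \<xi>) has_derivative (\<lambda>_. 0)) (at 0)"
  shows "(\<integral>\<^sup>+\<xi>. ennreal (exp (- (R \<xi> / 4))) \<partial>lborel) < \<infinity>"
proof -
  obtain c where c: "c > 0" "\<And>x. norm x \<ge> 1 \<Longrightarrow> R x \<ge> c * norm x"
    using R_linear_growth[OF flat, of 1] by auto
  have "exp (- (R \<xi> / 4)) \<le> exp (c / 4) * exp (- (c / 4 * norm \<xi>))" for \<xi>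
  proof -
    have "c * norm \<xi> \<le> c + R \<xi>"
    proof (cases "norm \<xi> \<ge> 1")
      case False
      then have "c * norm \<xi> \<le> c * 1" using c by (intro mult_left_mono) auto
      then show ?thesis using R_nonneg[of \<xi>] by simp
    qed (use c in force)
    then show ?thesis by (simp add: exp_add[symmetric])
  qed
  then have "(\<integral>\<^sup>+\<xi>. ennreal (exp (- (R \<xi> / 4))) \<partial>lborel)
     \<le> (\<integral>\<^sup>+(\<xi> :: real ^ 'd). ennreal (exp (c / 4)) * ennreal (exp (- (c / 4 * norm \<xi>))) \<partial>lborel)"
    by (intro nn_integral_mono) (simp add: ennreal_mult[symmetric] ennreal_leI)
  also have "\<dots> = ennreal (exp (c / 4)) * (\<integral>\<^sup>+(\<xi> :: real ^ 'd). ennreal (exp (- (c / 4 * norm \<xi>))) \<partial>lborel)"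
    by (rule nn_integral_cmult) simp
  also have "\<dots> < \<infinity>"
    using nn_integral_exp_neg_norm_finite[of "c / 4", where 'a = "real ^ 'd"] c
    by (simp add: ennreal_mult_less_top)
  finally show ?thesis .
qed

text \<open>The factor \<open>s\<close> is absorbed by the substitution \<open>T s\<close>, whose determinant is \<open>s powr trace E\<close>. This is where
the decay rate of the theorem comes from.\<close>

lemma integral_exp_R_scaling:
  assumes T: "\<And>t x. t > 0 \<Longrightarrow> T t x = powr_matrix t E *v x" and s: "s > 0"
  shows "(\<integral>\<^sup>+\<xi>. ennreal (exp (- (s * R (\<xi> - a) / 4))) \<partial>lborel)
     = ennreal (s powr (- trace E)) * (\<integral>\<^sup>+\<xi>. ennreal (exp (- (R \<xi> / 4))) \<partial>lborel)"
proof -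
  have [measurable]: "(\<lambda>\<xi>. R \<xi>) \<in> borel_measurable borel"
    using continuous_R by (rule borel_measurable_continuous_onI)
  let ?J = "\<integral>\<^sup>+\<xi>. ennreal (exp (- (s * R \<xi> / 4))) \<partial>lborel"
  have "(\<integral>\<^sup>+\<xi>. ennreal (exp (- (s * R (\<xi> - a) / 4))) \<partial>lborel)
     = (\<integral>\<^sup>+\<xi>. ennreal (exp (- (s * R (\<xi> - a) / 4))) \<partial>distr lborel borel ((+) a))"
    by (simp only: lborel_distr_plus)
  also have "\<dots> = ?J" by (subst nn_integral_distr) auto
  finally have shift: "(\<integral>\<^sup>+\<xi>. ennreal (exp (- (s * R (\<xi> - a) / 4))) \<partial>lborel) = ?J" .
  have det: "det (powr_matrix s E) = s powr trace E" by (rule det_powr_matrix[OF s])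
  have "(\<lambda>\<xi>. ennreal (exp (- (R \<xi> / 4)))) \<in> borel_measurable borel" by measurable
  then have "(\<integral>\<^sup>+\<xi>. ennreal (exp (- (R \<xi> / 4))) \<partial>lborel)
    = ennreal \<bar>det (powr_matrix s E)\<bar> * (\<integral>\<^sup>+\<xi>. ennreal (exp (- (R (powr_matrix s E *v \<xi>) / 4))) \<partial>lborel)"
    using nn_integral_linear_substitution[of "powr_matrix s E"] s unfolding det by simp
  also have "\<dots> = ennreal (s powr trace E) * ?J"
    using R_T[OF s] by (simp add: T[OF s] det)
  finally have "ennreal (s powr (- trace E)) * (\<integral>\<^sup>+\<xi>. ennreal (exp (- (R \<xi> / 4))) \<partial>lborel)
     = ennreal (s powr (- trace E)) * ennreal (s powr trace E) * ?J"
    by (simp add: mult.assoc)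
  also have "ennreal (s powr (- trace E)) * ennreal (s powr trace E) = 1"
    using s by (simp add: ennreal_mult[symmetric] powr_add[symmetric])
  finally show ?thesis unfolding shift by simp
qed

text \<open>Fourier inversion for the tilted convolution power, whose transform is the \<open>n\<close>-th power of the tilted
transform. The neighbourhoods of the maxima each contribute \<open>n powr (- trace E)\<close>, and the rest of the
torus an exponentially small term. The estimate holds for every \<open>\<nu>\<close>, with constants independent of \<open>\<nu>\<close>.\<close>

lemma tilted_conv_power_bound:
  fixes \<phi> :: "int ^ 'd \<Rightarrow> complex" and \<alpha> :: "real ^ 'd"
  assumes flat: "((\<lambda>\<xi>. R \<xi>) has_derivative (\<lambda>_. 0)) (at 0)"
    and T: "\<And>t x. t > 0 \<Longrightarrow> T t x = powr_matrix t E *v x"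
    and fin: "finite {x. \<phi> x \<noteq> 0}"
    and le1: "\<And>\<xi>. cmod (fourier \<phi> \<xi>) \<le> 1"
    and type: "\<And>\<xi>0. cmod (fourier \<phi> \<xi>0) = 1 \<Longrightarrow> positive_homogeneous_type \<phi> \<xi>0 \<alpha> P"
  obtains C M where "C > 0" "M > 0"
    "\<And>n x \<nu>. n \<ge> 1 \<Longrightarrow> cmod (conv_power \<phi> n x)
       \<le> C * real n powr (- trace E) * exp (real n * (\<alpha> \<bullet> \<nu> + M * R \<nu>) - real_vec x \<bullet> \<nu>)"
proof -
  obtain M \<kappa> D where M: "M > 0" and \<kappa>: "\<kappa> > 0" and D: "finite D" and est:
    "\<And>\<nu> \<xi>. \<xi> \<in> period_box \<Longrightarrow>
       cmod (fourier (tilt \<nu> \<phi>) \<xi>) \<le> exp (\<alpha> \<bullet> \<nu> + M * R \<nu> - \<kappa>) \<or>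
       (\<exists>a\<in>D. cmod (fourier (tilt \<nu> \<phi>) \<xi>) \<le> exp (\<alpha> \<bullet> \<nu> + M * R \<nu> - R (\<xi> - a) / 4))"
    using global_estimate[OF flat fin le1 type] by blast
  define \<mu> where "\<mu> = trace E"
  obtain C0 where C0: "C0 > 0" "\<And>n. n \<ge> 1 \<Longrightarrow> exp (- (\<kappa> * n)) \<le> C0 * n powr (- \<mu>)"
    using exp_decay_le_powr[OF \<kappa>] by blast
  obtain I where I: "I \<ge> 0" "(\<integral>\<^sup>+\<xi>. ennreal (exp (- (R \<xi> / 4))) \<partial>lborel) = ennreal I"
    using integral_exp_R_finite[OF flat]
    by (cases "\<integral>\<^sup>+\<xi>. ennreal (exp (- (R \<xi> / 4))) \<partial>lborel" rule: ennreal_cases) auto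
  have "emeasure lborel (period_box :: (real ^ 'd) set) < \<infinity>"
    unfolding period_box_eq_cbox by (rule emeasure_lborel_cbox_finite)
  then obtain v where v: "v \<ge> 0" "emeasure lborel (period_box :: (real ^ 'd) set) = ennreal v"
    by (cases "emeasure lborel (period_box :: (real ^ 'd) set)" rule: ennreal_cases) auto
  have box_borel: "(period_box :: (real ^ 'd) set) \<in> sets borel" unfolding period_box_eq_cbox by simp
  define C where "C = 1 + (C0 * v + real (card D) * I)"
  have C: "C > 0" using C0 v I by (simp add: C_def add_pos_nonneg)
  have [measurable]: "(\<lambda>\<xi>. R \<xi>) \<in> borel_measurable borel"
    using continuous_R by (rule borel_measurable_continuous_onI)
  have "cmod (conv_power \<phi> n x)
       \<le> C * real n powr (- \<mu>) * exp (real n * (\<alpha> \<bullet> \<nu> + M * R \<nu>) - real_vec x \<bullet> \<nu>)"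
    if n: "n \<ge> 1" for n x \<nu>
  proof -
    define \<psi> where "\<psi> = conv_power (tilt \<nu> \<phi>) n"
    define W where "W = exp (real n * (\<alpha> \<bullet> \<nu> + M * R \<nu>))"
    have W: "W > 0" by (simp add: W_def)
    obtain k where k: "n = Suc k" using n by (cases n) auto
    have fin_tilt: "finite {x. tilt \<nu> \<phi> x \<noteq> 0}" using fin by (simp add: tilt_eq_0_iff)
    have \<psi>_fin: "finite {x. \<psi> x \<noteq> 0}" and \<psi>_fourier: "fourier \<psi> \<xi> = fourier (tilt \<nu> \<phi>) \<xi> ^ n" for \<xi>
      using conv_power_finite_support_and_fourier[OF fin_tilt, of k] by (simp_all only: \<psi>_def k)
    have \<psi>_norm: "cmod (\<psi> x) = cmod (conv_power \<phi> n x) * exp (real_vec x \<bullet> \<nu>)"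
      unfolding \<psi>_def k conv_power_tilt by (simp add: tilt_def norm_mult)
    have pointwise: "cmod (fourier \<psi> \<xi>) \<le> W * (exp (- (\<kappa> * real n)) + (\<Sum>a\<in>D. exp (- (real n * R (\<xi> - a) / 4))))"
      if \<xi>: "\<xi> \<in> period_box" for \<xi>
    proof -
      have nonneg: "(\<Sum>a\<in>D. exp (- (real n * R (\<xi> - a) / 4))) \<ge> 0" by (simp add: sum_nonneg)
      (* Both alternatives of the global estimate have the form exp (\<alpha> \<bullet> \<nu> + M * R \<nu> - u), whose n-th power is treated at once. *)
      have pow: "cmod (fourier \<psi> \<xi>) \<le> W * exp (- (real n * u))"
        if "cmod (fourier (tilt \<nu> \<phi>) \<xi>) \<le> exp (\<alpha> \<bullet> \<nu> + M * R \<nu> - u)" for u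
      proof -
        have "cmod (fourier \<psi> \<xi>) \<le> exp (\<alpha> \<bullet> \<nu> + M * R \<nu> - u) ^ n"
          unfolding \<psi>_fourier norm_power using that by (intro power_mono) auto
        also have "\<dots> = W * exp (- (real n * u))"
          by (simp add: W_def exp_of_nat_mult[symmetric] exp_add[symmetric] algebra_simps)
        finally show ?thesis .
      qed
      from est[OF \<xi>, of \<nu>] show ?thesis
      proof
        assume "cmod (fourier (tilt \<nu> \<phi>) \<xi>) \<le> exp (\<alpha> \<bullet> \<nu> + M * R \<nu> - \<kappa>)"
        from pow[OF this] have "cmod (fourier \<psi> \<xi>) \<le> W * exp (- (\<kappa> * real n))" by (simp add: mult.commute)
        also have "\<dots> \<le> W * (exp (- (\<kappa> * real n)) + (\<Sum>a\<in>D. exp (- (real n * R (\<xi> - a) / 4))))"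
          using W nonneg by (intro mult_left_mono) auto
        finally show ?thesis .
      next
        assume "\<exists>a\<in>D. cmod (fourier (tilt \<nu> \<phi>) \<xi>) \<le> exp (\<alpha> \<bullet> \<nu> + M * R \<nu> - R (\<xi> - a) / 4)"
        then obtain a where a: "a \<in> D" "cmod (fourier (tilt \<nu> \<phi>) \<xi>) \<le> exp (\<alpha> \<bullet> \<nu> + M * R \<nu> - R (\<xi> - a) / 4)" by blast
        from pow[OF a(2)] have "cmod (fourier \<psi> \<xi>) \<le> W * exp (- (real n * R (\<xi> - a) / 4))" by simp
        also have "\<dots> \<le> W * (\<Sum>a\<in>D. exp (- (real n * R (\<xi> - a) / 4)))"
          using W a(1) D by (intro mult_left_mono member_le_sum) auto
        also have "\<dots> \<le> W * (exp (- (\<kappa> * real n)) + (\<Sum>a\<in>D. exp (- (real n * R (\<xi> - a) / 4))))"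
          using W by (intro mult_left_mono) auto
        finally show ?thesis .
      qed
    qed
    have n0: "real n > 0" using n by simp
    have "ennreal ((2 * pi) ^ CARD('d) * cmod (\<psi> x))
       \<le> (\<integral>\<^sup>+\<xi>. indicator period_box \<xi> * ennreal (cmod (fourier \<psi> \<xi>)) \<partial>lborel)"
      by (rule norm_le_integral_fourier[OF \<psi>_fin])
    also have "\<dots> \<le> (\<integral>\<^sup>+\<xi>. ennreal W * (ennreal (exp (- (\<kappa> * real n))) * indicator period_box \<xi>
         + (\<Sum>a\<in>D. ennreal (exp (- (real n * R (\<xi> - a) / 4))))) \<partial>lborel)"
    proof (rule nn_integral_mono)
      fix \<xi> :: "real ^ 'd"
      show "indicator period_box \<xi> * ennreal (cmod (fourier \<psi> \<xi>))
        \<le> ennreal W * (ennreal (exp (- (\<kappa> * real n))) * indicator period_box \<xi>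
         + (\<Sum>a\<in>D. ennreal (exp (- (real n * R (\<xi> - a) / 4)))))"
      proof (cases "\<xi> \<in> period_box")
        case True
        have "ennreal (cmod (fourier \<psi> \<xi>)) \<le> ennreal (W * (exp (- (\<kappa> * real n)) + (\<Sum>a\<in>D. exp (- (real n * R (\<xi> - a) / 4)))))"
          using pointwise[OF True] by (rule ennreal_leI)
        also have "\<dots> = ennreal W * (ennreal (exp (- (\<kappa> * real n))) + (\<Sum>a\<in>D. ennreal (exp (- (real n * R (\<xi> - a) / 4)))))"
          using W by (simp add: ennreal_mult sum_nonneg)
        finally show ?thesis using True by simp
      qed simp
    qed
    also have "\<dots> = ennreal W * (ennreal (exp (- (\<kappa> * real n))) * ennreal v
         + (\<Sum>a\<in>D. ennreal (real n powr (- \<mu>)) * ennreal I))"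
    proof -
      have "(\<integral>\<^sup>+(\<xi> :: real ^ 'd). ennreal (exp (- (\<kappa> * real n))) * indicator period_box \<xi> \<partial>lborel)
          = ennreal (exp (- (\<kappa> * real n))) * ennreal v"
        using box_borel v(2) by (simp add: nn_integral_cmult_indicator)
      moreover have "(\<integral>\<^sup>+\<xi>. (\<Sum>a\<in>D. ennreal (exp (- (real n * R (\<xi> - a) / 4)))) \<partial>lborel)
          = (\<Sum>a\<in>D. ennreal (real n powr (- \<mu>)) * ennreal I)"
        using integral_exp_R_scaling[OF T n0] by (subst nn_integral_sum) (auto simp: I(2) \<mu>_def)
      ultimately show ?thesis
        using box_borel by (subst nn_integral_cmult, measurable) (subst nn_integral_add, auto)
    qed
    also have "\<dots> = ennreal (W * (exp (- (\<kappa> * real n)) * v + real (card D) * (real n powr (- \<mu>) * I)))"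
      using W v(1) I(1) by (simp add: ennreal_mult ennreal_of_nat_eq_real_of_nat)
    finally have "(2 * pi) ^ CARD('d) * cmod (\<psi> x) \<le> W * (exp (- (\<kappa> * real n)) * v + real (card D) * (real n powr (- \<mu>) * I))"
      using W v(1) I(1) by (simp add: ennreal_le_iff)
    also have "\<dots> \<le> W * (C0 * real n powr (- \<mu>) * v + real (card D) * (real n powr (- \<mu>) * I))"
      using W v(1) C0(2)[of "real n"] n by (intro mult_left_mono add_mono mult_right_mono) auto
    also have "\<dots> \<le> W * (C * real n powr (- \<mu>))"
      using W by (intro mult_left_mono) (auto simp: C_def algebra_simps)
    finally have "(2 * pi) ^ CARD('d) * cmod (\<psi> x) \<le> W * (C * real n powr (- \<mu>))" .
    moreover have "1 * cmod (\<psi> x) \<le> (2 * pi) ^ CARD('d) * cmod (\<psi> x)"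
      using pi_ge_two by (intro mult_right_mono one_le_power) auto
    ultimately have "cmod (conv_power \<phi> n x) * exp (real_vec x \<bullet> \<nu>) \<le> W * (C * real n powr (- \<mu>))"
      unfolding \<psi>_norm by linarith
    then have "cmod (conv_power \<phi> n x) \<le> W * (C * real n powr (- \<mu>)) / exp (real_vec x \<bullet> \<nu>)"
      by (simp add: field_simps)
    also have "\<dots> = C * real n powr (- \<mu>) * exp (real n * (\<alpha> \<bullet> \<nu> + M * R \<nu>) - real_vec x \<bullet> \<nu>)"
      by (simp add: W_def exp_diff)
    finally show ?thesis .
  qed
  then show ?thesis using that[OF C M] unfolding \<mu>_def by blast
qed

end

text \<open>A bound for every \<open>\<nu>\<close> bounds the function under the supremum from above, and so passes to the
supremum itself.\<close>

lemma le_exp_legendre_fenchel: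
  assumes c: "c \<ge> 0" and B: "B > 0" and t: "t > 0"
    and le: "\<And>\<nu>. c \<le> B * exp (- (t * (y \<bullet> \<nu> - R \<nu>)))"
  shows "c \<le> B * exp (- (t * legendre_fenchel R y))"
proof (cases "c = 0")
  case True then show ?thesis using B by simp
next
  case False
  then have c0: "c > 0" using c by simp
  have "y \<bullet> \<nu> - R \<nu> \<le> ln (B / c) / t" for \<nu>
  proof -
    have "ln c \<le> ln (B * exp (- (t * (y \<bullet> \<nu> - R \<nu>))))" using le[of \<nu>] c0 B by simp
    also have "\<dots> = ln B - t * (y \<bullet> \<nu> - R \<nu>)" using B by (simp add: ln_mult)
    finally show ?thesis using t c0 B by (simp add: ln_div field_simps)
  qed
  then have "legendre_fenchel R y \<le> ln (B / c) / t"
    unfolding legendre_fenchel_def by (intro cSUP_least) auto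
  then have "t * legendre_fenchel R y \<le> ln (B / c)" using t by (simp add: field_simps)
  then have "exp (- ln (B / c)) \<le> exp (- (t * legendre_fenchel R y))" by simp
  moreover have "exp (- ln (B / c)) = c / B" using c0 B by (simp add: exp_minus)
  ultimately show ?thesis using B by (simp add: field_simps)
qed

text \<open>A nonnegative differentiable function has vanishing derivative at a zero.\<close>

lemma positive_definite_polynomial_flat_at_0:
  fixes P :: "real ^ 'd::finite \<Rightarrow> complex"
  assumes poly: "polynomial_function P" and pos: "\<And>\<xi>. Re (P \<xi>) \<ge> 0" and P0: "P 0 = 0"
  shows "((\<lambda>\<xi>. Re (P \<xi>)) has_derivative (\<lambda>_. 0)) (at 0)"
proof -
  have "P differentiable (at 0)" using poly by (rule differentiable_at_polynomial_function)
  then obtain P' where "(P has_derivative P') (at 0)" by (auto simp: differentiable_def)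
  then have d: "((\<lambda>\<xi>. Re (P \<xi>)) has_derivative (\<lambda>h. Re (P' h))) (at 0)"
    by (rule bounded_linear.has_derivative[OF bounded_linear_Re])
  have "(\<lambda>h. Re (P' h)) = (\<lambda>_. 0)"
    by (rule differential_zero_maxmin[OF _ open_UNIV d]) (use pos P0 in auto)
  with d show ?thesis by simp
qed

theorem theorem1p6:
  fixes \<phi> :: "int ^ 'd::finite \<Rightarrow> complex"
    and \<alpha> :: "real ^ 'd"
    and P :: "real ^ 'd \<Rightarrow> complex"
  assumes "finite {x. \<phi> x \<noteq> 0}"
    and "(SUP \<xi>\<in>torus. cmod (fourier \<phi> \<xi>)) = 1"
    and "\<forall>\<xi>\<in>Omega \<phi>. positive_homogeneous_type \<phi> \<xi> \<alpha> P"
  shows "\<exists>C>0. \<exists>M>0. \<forall>n\<ge>1. \<forall>x.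
    cmod (conv_power \<phi> n x) \<le>
      C / real n powr homogeneous_order P *
      exp (- (real n * M *
        legendre_fenchel (\<lambda>\<xi>. Re (P \<xi>)) ((real_vec x - real n *\<^sub>R \<alpha>) /\<^sub>R real n)))"
proof -
  obtain \<xi>1 where "\<xi>1 \<in> Omega \<phi>" using Omega_nonempty[OF assms(1,2)] by blast
  then have "positive_homogeneous_polynomial P"
    using assms(3) by (auto simp: positive_homogeneous_type_def)
  then have poly: "polynomial_function P" and cont: "continuous_on UNIV P"
    and pos: "positive_definite_fun (\<lambda>\<xi>. Re (P \<xi>))" and ex: "\<exists>E. E \<in> Exp_set P"
    by (auto simp: positive_homogeneous_polynomial_def positive_homogeneous_def)
  define E where "E = (SOME E. E \<in> Exp_set P)"
  have E: "E \<in> Exp_set P" unfolding E_def using ex by (rule someI_ex)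
  have order: "homogeneous_order P = trace E" by (simp add: homogeneous_order_def E_def)
  interpret complex_homogeneous_flow P "\<lambda>t \<xi>. powr_matrix t E *v \<xi>"
    by (rule complex_homogeneous_flow_powr_matrix[OF cont pos E])
  have flat: "((\<lambda>\<xi>. R \<xi>) has_derivative (\<lambda>_. 0)) (at 0)"
    using positive_definite_polynomial_flat_at_0[OF poly R_nonneg P_0] .
  have type: "positive_homogeneous_type \<phi> \<xi>0 \<alpha> P" if "cmod (fourier \<phi> \<xi>0) = 1" for \<xi>0
  proof -
    obtain m where "\<xi>0 + (2 * pi) *\<^sub>R real_vec m \<in> torus" by (rule translate_into_torus)
    then have "\<xi>0 + (2 * pi) *\<^sub>R real_vec m \<in> Omega \<phi>" using that by (simp add: Omega_def fourier_periodic)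
    then show ?thesis using assms(3) positive_homogeneous_type_translate by blast
  qed
  obtain C M where C: "C > 0" and M: "M > 0" and bound:
    "\<And>n x \<nu>. n \<ge> 1 \<Longrightarrow> cmod (conv_power \<phi> n x)
       \<le> C * real n powr (- trace E) * exp (real n * (\<alpha> \<bullet> \<nu> + M * R \<nu>) - real_vec x \<bullet> \<nu>)"
    using tilted_conv_power_bound[OF flat refl assms(1) norm_fourier_le_one[OF assms(1,2)] type] by blast
  (* Superlinearity of R provides a scalar s with M * R (s \<nu>) \<le> s * R \<nu>; it becomes the constant in front of the transform. *)
  have "1 / M > 0" using M by simp
  then obtain s where s: "0 < s" "\<And>x. R (s *\<^sub>R x) \<le> 1 / M * s * R x"
    by (rule R_scaleR_le[OF flat]) blast
  have "cmod (conv_power \<phi> n x) \<le> C / real n powr homogeneous_order P *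
      exp (- (real n * s * legendre_fenchel (\<lambda>\<xi>. Re (P \<xi>)) ((real_vec x - real n *\<^sub>R \<alpha>) /\<^sub>R real n)))"
    if n: "n \<ge> 1" for n x
  proof (rule le_exp_legendre_fenchel)
    have n0: "real n > 0" using n by simp
    show "0 < C / real n powr homogeneous_order P" "0 < real n * s" using C n0 s by auto
    fix \<nu> :: "real ^ 'd"
    let ?y = "(real_vec x - real n *\<^sub>R \<alpha>) /\<^sub>R real n"
    have y: "real n * (?y \<bullet> \<nu>) = real_vec x \<bullet> \<nu> - real n * (\<alpha> \<bullet> \<nu>)"
      using n0 by (simp add: inner_diff_left)
    (* The bound is used at s \<nu> instead of \<nu>. *)
    have "M * R (s *\<^sub>R \<nu>) \<le> M * (1 / M * s * R \<nu>)"
      using M s(2)[of \<nu>] by (intro mult_left_mono) auto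
    then have "real n * (M * R (s *\<^sub>R \<nu>)) \<le> real n * (s * R \<nu>)"
      using M n0 by (intro mult_left_mono) auto
    moreover have "real n * s * (?y \<bullet> \<nu> - R \<nu>) = s * (real n * (?y \<bullet> \<nu>)) - real n * (s * R \<nu>)"
      by (simp add: right_diff_distrib mult_ac)
    ultimately have "real n * (\<alpha> \<bullet> (s *\<^sub>R \<nu>) + M * R (s *\<^sub>R \<nu>)) - real_vec x \<bullet> (s *\<^sub>R \<nu>)
        \<le> - (real n * s * (?y \<bullet> \<nu> - R \<nu>))"
      unfolding y by (simp add: algebra_simps)
    then have "exp (real n * (\<alpha> \<bullet> (s *\<^sub>R \<nu>) + M * R (s *\<^sub>R \<nu>)) - real_vec x \<bullet> (s *\<^sub>R \<nu>))
        \<le> exp (- (real n * s * (?y \<bullet> \<nu> - R \<nu>)))" by simp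
    then have "C * real n powr (- trace E) * exp (real n * (\<alpha> \<bullet> (s *\<^sub>R \<nu>) + M * R (s *\<^sub>R \<nu>)) - real_vec x \<bullet> (s *\<^sub>R \<nu>))
        \<le> C * real n powr (- trace E) * exp (- (real n * s * (?y \<bullet> \<nu> - R \<nu>)))"
      using C by (intro mult_left_mono) auto
    with bound[OF n, of x "s *\<^sub>R \<nu>"]
    show "cmod (conv_power \<phi> n x) \<le> C / real n powr homogeneous_order P * exp (- (real n * s * (?y \<bullet> \<nu> - R \<nu>)))"
      by (simp add: order powr_minus divide_inverse)
  qed simp
  then show ?thesis using C s(1) by blast
qed

end
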